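(* Let $X$ be a finite-dimensional real inner product space, $\Omega\subset X$ a pointed solid closed convex cone such that $\Omega^*$ is facially compact and locally smooth, and let $1\le j\le d$. The image of $\mathcal P_j$ under $(\xi,\mathbf e)$, $(E,F)\mapsto(E,e_F(E))$, is a closed $\mathcal C^{1,0}$ submanifold of $\xi(\mathcal P_j)\times X$ (regarded as a $\mathcal C^{1,0}$ manifold over $\xi(\mathcal P_j)$ via the first projection). This defines a $\mathcal C^{1,0}$ manifold structure on $\mathcal P_j$ over $\xi(\mathcal P_j)\subset P_{j-1}$ such that the fibrewise tangent space at $(E,F)\in\mathcal P_j$ is $E_{1/2}(F)$.
   Context: For $A\subset X$: $\operatorname{span}A$, $A^\perp$, $A^*=\{y:\langle y,a\rangle\ge0\ \forall a\in A\}$, $A^\circledast=A^*\cap\operatorname{span}A$. Faces of a convex set $C$: subsets $F$ such that every segment in $C$ with midpoint in $F$ lies in $F$. Let $0=n_0<\dots<n_d=\dim X$ be the dimensions of faces of $\Omega^*$, $P_j$ the set of faces of dimension $n_{d-j}$, topologised as a subspace of the closed subsets of $X$ with the Fell topology; facially compact means each $P_j$ is compact. A face $E$ of a cone $C$ is modular if it contains a face of dimension $\max\{\dim G:G\text{ face of }C,\dim G<\dim E\}$; such $E$ is smooth if the relative interiors of all its faces of that dimension consist of regular points of $E$ (unique supporting hyperplane); $C$ is locally smooth if all modular faces are smooth. $\mathcal P_j=\{(E,F)\in P_{j-1}\times P_j:E\supset F\}$, $\xi(E,F)=E$. Under the assumptions $F^\perp\cap E^\circledast$ is an extreme ray of $E^\circledast$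 with unit generator $e_F(E)$, and $E_{1/2}(F)=\operatorname{span}(E)\cap F^\perp\cap e_F(E)^\perp$. A closed $\mathcal C^{1,0}$ submanifold of $B\times X$ over $B$ is a closed subset whose fibres are $\mathcal C^1$ submanifolds of $X$ of constant dimension admitting local $\mathcal C^1$ parametrisations depending continuously (in the $\mathcal C^1$ topology) on the base point. *)

theory Defs
  imports "HOL-Analysis.Analysis"
begin

definition dual_cone :: "'a::real_inner set \<Rightarrow> 'a set" where
  "dual_cone A = {y. \<forall>a\<in>A. y \<bullet> a \<ge> 0}"

definition rel_dual_cone :: "'a::real_inner set \<Rightarrow> 'a set" where
  "rel_dual_cone A = dual_cone A \<inter> span A"

definition orth :: "'a::real_inner set \<Rightarrow> 'a set" where
  "orth A = {y. \<forall>a\<in>A. y \<bullet> a = 0}"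

definition pointed_cone :: "'a::real_vector set \<Rightarrow> bool" where
  "pointed_cone C \<longleftrightarrow> C \<inter> uminus ` C = {0}"

definition solid :: "'a::topological_space set \<Rightarrow> bool" where
  "solid C \<longleftrightarrow> interior C \<noteq> {}"

definition faces :: "'a::euclidean_space set \<Rightarrow> 'a set set" where
  "faces C = {F. F face_of C \<and> F \<noteq> {}}"

definition face_dims :: "'a::euclidean_space set \<Rightarrow> nat set" where
  "face_dims C = dim ` faces C"

text \<open>d, where 0 = n_0 < ... < n_d are the face dimensions.\<close>
definition fdepth :: "'a::euclidean_space set \<Rightarrow> nat" where
  "fdepth C = card (face_dims C) - 1"

definition fdim_n :: "'a::euclidean_space set \<Rightarrow> nat \<Rightarrow> nat" where
  "fdim_n C k = sorted_list_of_set (face_dims C) ! k"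

definition Pfaces :: "'a::euclidean_space set \<Rightarrow> nat \<Rightarrow> 'a set set" where
  "Pfaces C j = {F \<in> faces C. dim F = fdim_n C (fdepth C - j)}"

definition fell_topology :: "'a::euclidean_space set topology" where
  "fell_topology = subtopology
     (topology_generated_by
        ({{A. A \<inter> U \<noteq> {}} | U. open U} \<union> {{A. A \<inter> K = {}} | K. compact K}))
     {A. closed A}"

definition facially_compact :: "'a::euclidean_space set \<Rightarrow> bool" where
  "facially_compact C \<longleftrightarrow> (\<forall>j \<le> fdepth C. compactin fell_topology (Pfaces C j))"

definition lower_dim :: "'a::euclidean_space set \<Rightarrow> 'a set \<Rightarrow> nat" where
  "lower_dim C E = Max {dim G | G. G \<in> faces C \<and> dim G < dim E}"

definition modular_face :: "'a::euclidean_space set \<Rightarrow> 'a set \<Rightarrow> bool" where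
  "modular_face C E \<longleftrightarrow> E \<in> faces C \<and> (\<exists>G\<in>faces C. dim G < dim E) \<and>
     (\<exists>G\<in>faces C. G \<subseteq> E \<and> dim G = lower_dim C E)"

definition supporting_hyperplanes :: "'a::euclidean_space set \<Rightarrow> 'a \<Rightarrow> 'a set set" where
  "supporting_hyperplanes E x = {H. \<exists>y c. y \<in> span E \<and> y \<noteq> 0 \<and>
       H = {z \<in> span E. y \<bullet> z = c} \<and> (\<forall>e\<in>E. y \<bullet> e \<ge> c) \<and> y \<bullet> x = c}"

definition regular_point :: "'a::euclidean_space set \<Rightarrow> 'a \<Rightarrow> bool" where
  "regular_point E x \<longleftrightarrow> x \<in> E \<and> (\<exists>!H. H \<in> supporting_hyperplanes E x)"

definition smooth_face :: "'a::euclidean_space set \<Rightarrow> 'a set \<Rightarrow> bool" where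
  "smooth_face C E \<longleftrightarrow> modular_face C E \<and>
     (\<forall>G. G face_of E \<and> G \<noteq> {} \<and> dim G = lower_dim C E \<longrightarrow>
          (\<forall>x\<in>rel_interior G. regular_point E x))"

definition locally_smooth :: "'a::euclidean_space set \<Rightarrow> bool" where
  "locally_smooth C \<longleftrightarrow> (\<forall>E. modular_face C E \<longrightarrow> smooth_face C E)"

definition PP :: "'a::euclidean_space set \<Rightarrow> nat \<Rightarrow> ('a set \<times> 'a set) set" where
  "PP C j = {(E, F). E \<in> Pfaces C (j - 1) \<and> F \<in> Pfaces C j \<and> F \<subseteq> E}"

definition xi :: "'a set \<times> 'a set \<Rightarrow> 'a set" where
  "xi p = fst p"

definition e_vec :: "'a::euclidean_space set \<Rightarrow> 'a set \<Rightarrow> 'a" where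
  "e_vec E F = (SOME e. norm e = 1 \<and>
      orth F \<inter> rel_dual_cone E = {t *\<^sub>R e | t. t \<ge> 0} \<and>
      {t *\<^sub>R e | t. t \<ge> 0} face_of rel_dual_cone E)"

definition E_half :: "'a::euclidean_space set \<Rightarrow> 'a set \<Rightarrow> 'a set" where
  "E_half E F = span E \<inter> orth F \<inter> orth {e_vec E F}"

text \<open>A closed subset S of B \<times> X (B carrying topology T) whose fibres are C^1 submanifolds
  of X of a common dimension k, admitting local C^1 parametrisations (defined on open subsets
  of a k-dimensional linear subspace L of X, i.e. of a copy of R^k) depending continuously on
  the base point in the (compact-open) C^1 topology.\<close>
definition c10_submanifold :: "'b topology \<Rightarrow> ('b \<times> 'a::euclidean_space) set \<Rightarrow> bool" where
  "c10_submanifold T S \<longleftrightarrow>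
     closedin (prod_topology T euclidean) S \<and>
     (\<exists>k. \<forall>(b0, x0)\<in>S. \<exists>W V L U \<phi> D.
        openin T W \<and> b0 \<in> W \<and> open V \<and> x0 \<in> V \<and>
        subspace (L::'a set) \<and> dim L = k \<and> openin (top_of_set L) U \<and>
        (\<forall>b\<in>W.
           (\<forall>u\<in>U. (\<phi> b has_derivative blinfun_apply (D b u)) (at u within L) \<and>
                   (\<forall>v\<in>L. blinfun_apply (D b u) v = 0 \<longrightarrow> v = 0)) \<and>
           continuous_on U (D b) \<and>
           (\<exists>g. homeomorphism U ({x. (b, x) \<in> S} \<inter> V) (\<phi> b) g)) \<and>
        (\<forall>b\<in>W. \<forall>K. compact K \<and> K \<subseteq> U \<longrightarrow>
           (\<forall>\<epsilon>>0. \<exists>N. openin T N \<and> b \<in> N \<and>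
              (\<forall>b'\<in>N \<inter> W. \<forall>u\<in>K. dist (\<phi> b' u) (\<phi> b u) < \<epsilon> \<and>
                                   norm (D b' u - D b u) < \<epsilon>))))"

definition tangent_space :: "'a::euclidean_space set \<Rightarrow> 'a \<Rightarrow> 'a set" where
  "tangent_space M x = {v. \<exists>\<gamma> \<epsilon>. \<epsilon> > 0 \<and> \<gamma> 0 = x \<and> (\<forall>t. \<bar>t\<bar> < \<epsilon> \<longrightarrow> \<gamma> t \<in> M) \<and>
                            (\<gamma> has_vector_derivative v) (at 0)}"

end

theory Submission
  imports Defs
begin

text \<open>
  Let \<open>m < r\<close> be the dimensions of the faces in \<open>P\<^sub>j\<close> and \<open>P\<^sub>j\<^sub>-\<^sub>1\<close>. By local smoothness the fibre over \<open>E\<close>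
  consists of the unit vectors \<open>g\<close> in the span of \<open>E\<close> which are nonnegative on \<open>E\<close> and whose contact face
  \<open>E \<inter> g\<^sup>\<bottom>\<close> has dimension \<open>m\<close>. By facial compactness contact faces depend continuously on \<open>(E, g)\<close>, and
  the bundle is closed. If \<open>g\<close> and \<open>h\<close> are normals of \<open>E\<close> close to each other, then \<open>h - g\<close> is nonnegative on
  the contact face of \<open>g\<close> and nonpositive on that of \<open>h\<close>; hence every limit of secant directions is
  orthogonal to the contact face. Rescaling the normals near a base point \<open>e\<close> by \<open>g \<bullet> e = 1\<close>, the
  orthogonal projection to the expected tangent space is therefore an injective coordinate whose
  inverse is continuously differentiable, jointly in \<open>E\<close>. The coordinate attains all small values:
  the required normals are gradients at minimisers over \<open>E\<close> of linear forms with a quadratic penalty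
  along the contact face.
\<close>

text \<open>A face varies only as a closed convex set: it has no defining equations depending
  differentiably on it, so an implicit function theorem has nothing to act on. Uniform statements
  are instead obtained by refuting convergent sequences of counterexamples; distances to a dense
  sequence bring compactness in the Fell topology down to sequences. The constant 2 in the estimates
  only has to exceed 1, because limits of unit secants are fixed by the projection. Two facts govern
  the limits: faces of equal dimension subconverge to a face of that dimension, and no face
  dimension lies strictly between m and r. The one keeps the dimension of contact faces from
  dropping, the other from growing. The rescaling g \<bullet> e = 1 makes differences of normals
  exactly orthogonal to e; on the sphere this holds only in the limit. Surjectivity of the
  coordinate is the delicate point, since compactness yields limits of given normals but no new
  ones; hence the minimisers. Local smoothness is what identifies the unit normals with the vectors
  e_F(E).\<close>

section \<open>Subsequences and orthogonal projections\<close>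

text \<open>Infinitely many failures would form a subsequence of failures, so eventual statements
  become accessible to compactness.\<close>

lemma eventually_sequentially_via_subseq:
  assumes "\<And>f::nat \<Rightarrow> nat. strict_mono f \<Longrightarrow> \<exists>n. Q (f n)"
  shows "eventually Q sequentially"
proof (rule ccontr)
  assume "\<not> eventually Q sequentially"
  then have "\<forall>N. \<exists>n>N. \<not> Q n"
    unfolding eventually_sequentially by (metis Suc_le_lessD)
  then have "infinite {n. \<not> Q n}"
    unfolding infinite_nat_iff_unbounded by simp
  then obtain f :: "nat \<Rightarrow> nat" where "strict_mono f" "\<forall>n. f n \<in> {n. \<not> Q n}"
    using infinite_enumerate by blast
  with assms show False by blast
qed

text \<open>\<open>h\<close> need not be monotone: one index close to \<open>l\<close> along each
  subsequence already excludes infinitely many distant ones.\<close>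

lemma tendsto_via_subseq:
  fixes x :: "nat \<Rightarrow> 'a::metric_space"
  assumes "\<And>f::nat \<Rightarrow> nat. strict_mono f \<Longrightarrow> \<exists>h::nat \<Rightarrow> nat. (\<lambda>n. x (f (h n))) \<longlonglongrightarrow> l"
  shows "x \<longlonglongrightarrow> l"
proof (rule metric_LIMSEQ_I)
  fix e :: real assume "0 < e"
  have "eventually (\<lambda>n. dist (x n) l < e) sequentially"
  proof (rule eventually_sequentially_via_subseq)
    fix f :: "nat \<Rightarrow> nat" assume "strict_mono f"
    then obtain h where "(\<lambda>n. x (f (h n))) \<longlonglongrightarrow> l" using assms by blast
    then show "\<exists>n. dist (x (f n)) l < e"
      using \<open>0 < e\<close> metric_LIMSEQ_D by (metis order_refl)
  qed
  then show "\<exists>N. \<forall>n\<ge>N. dist (x n) l < e" by (simp add: eventually_sequentially)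
qed

lemma bounded_convergent_subseq:
  fixes x :: "nat \<Rightarrow> 'a::euclidean_space"
  assumes "\<And>n. norm (x n) \<le> K"
  obtains f l where "strict_mono f" "(\<lambda>n. x (f n)) \<longlonglongrightarrow> l"
proof -
  have "bounded (range x)" using assms by (auto simp: bounded_iff)
  from bounded_imp_convergent_subsequence[OF this] show ?thesis
    using that by (auto simp: o_def)
qed

lemma tendsto_via_limit_points:
  fixes x :: "nat \<Rightarrow> 'a::euclidean_space"
  assumes "\<And>n. norm (x n) \<le> K"
    and "\<And>f l'. strict_mono f \<Longrightarrow> (\<lambda>n. x (f n)) \<longlonglongrightarrow> l' \<Longrightarrow> l' = l"
  shows "x \<longlonglongrightarrow> l"
proof (rule tendsto_via_subseq)
  fix f :: "nat \<Rightarrow> nat" assume f: "strict_mono f"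
  obtain h l' where h: "strict_mono h" "(\<lambda>n. x (f (h n))) \<longlonglongrightarrow> l'"
    using bounded_convergent_subseq[of "\<lambda>n. x (f n)" K] assms(1) by blast
  have "l' = l"
    using assms(2)[OF strict_mono_o[OF f h(1)]] h(2) by (simp add: o_def)
  with h show "\<exists>h. (\<lambda>n. x (f (h n))) \<longlonglongrightarrow> l" by blast
qed

text \<open>The characterisation by inner products makes computing a projection a matter of
  exhibiting a point, through \<open>orth_proj_unique\<close>.\<close>

definition orth_proj :: "'a::euclidean_space set \<Rightarrow> 'a \<Rightarrow> 'a" where
  "orth_proj L x = (THE p. p \<in> L \<and> (\<forall>l\<in>L. p \<bullet> l = x \<bullet> l))"

lemma orth_proj_unique:
  assumes "subspace L" "p \<in> L" "\<And>l. l \<in> L \<Longrightarrow> p \<bullet> l = x \<bullet> l"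
  shows "orth_proj L x = p"
  unfolding orth_proj_def
proof (rule the_equality)
  fix q assume q: "q \<in> L \<and> (\<forall>l\<in>L. q \<bullet> l = x \<bullet> l)"
  then have "q - p \<in> L" using assms subspace_diff by blast
  then have "(q - p) \<bullet> (q - p) = 0" using q assms by (simp add: inner_diff_left)
  then show "q = p" by simp
qed (use assms in auto)

lemma orth_proj:
  assumes "subspace L"
  shows "orth_proj L x \<in> L" and "l \<in> L \<Longrightarrow> orth_proj L x \<bullet> l = x \<bullet> l"
proof -
  obtain y z where yz: "y \<in> span L" "\<And>w. w \<in> span L \<Longrightarrow> orthogonal z w" "x = y + z"
    using orthogonal_subspace_decomp_exists[of L x] by metis
  have sp: "span L = L" using assms by (simp add: span_eq_iff)
  have "orth_proj L x = y"
    by (rule orth_proj_unique[OF assms]) (use yz in \<open>auto simp: sp inner_add_left orthogonal_def\<close>)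
  then show "orth_proj L x \<in> L" and "l \<in> L \<Longrightarrow> orth_proj L x \<bullet> l = x \<bullet> l"
    using yz by (auto simp: sp inner_add_left orthogonal_def)
qed

lemma orth_proj_id: "subspace L \<Longrightarrow> x \<in> L \<Longrightarrow> orth_proj L x = x"
  by (rule orth_proj_unique) auto

lemma norm_orth_proj_le: "subspace L \<Longrightarrow> norm (orth_proj L x) \<le> norm x"
proof -
  assume L: "subspace L"
  have "norm (orth_proj L x) * norm (orth_proj L x) = x \<bullet> orth_proj L x"
    using orth_proj(2)[OF L orth_proj(1)[OF L], of x x]
    by (simp flip: power2_eq_square add: power2_norm_eq_inner)
  also have "\<dots> \<le> norm x * norm (orth_proj L x)" by (rule norm_cauchy_schwarz)
  finally show ?thesis
    by (cases "norm (orth_proj L x) = 0") auto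
qed

lemma bounded_linear_orth_proj: "subspace L \<Longrightarrow> bounded_linear (orth_proj L)"
proof (rule bounded_linear_intro[of _ 1])
  assume L: "subspace L"
  show "orth_proj L (x + y) = orth_proj L x + orth_proj L y" for x y
    by (rule orth_proj_unique[OF L])
      (auto simp: orth_proj[OF L] inner_add_left intro: subspace_add[OF L])
  show "orth_proj L (c *\<^sub>R x) = c *\<^sub>R orth_proj L x" for c x
    by (rule orth_proj_unique[OF L]) (auto simp: orth_proj[OF L] intro: subspace_scale[OF L])
  show "norm (orth_proj L x) \<le> norm x * 1" for x using norm_orth_proj_le[OF L] by simp
qed

text \<open>The normalised vectors accumulate at a unit vector of \<open>L\<close>, which the
  projection fixes, while their projections keep norm at most 1/2. All uniform lower bounds for
  projections below are instances of this.\<close>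

lemma sgn_limit_contradiction:
  fixes x :: "nat \<Rightarrow> 'a::euclidean_space"
  assumes L: "subspace L"
    and x: "\<And>n. 2 * norm (orth_proj L (x n)) < norm (x n)"
    and lim: "\<And>f l. strict_mono f \<Longrightarrow> (\<lambda>n. sgn (x (f n))) \<longlonglongrightarrow> l \<Longrightarrow> l \<in> L"
  shows False
proof -
  interpret P: bounded_linear "orth_proj L" by (rule bounded_linear_orth_proj[OF L])
  have x0: "norm (sgn (x n)) = 1" for n
    using x[of n] norm_ge_zero[of "orth_proj L (x n)"] by (auto simp: norm_sgn)
  obtain f l where f: "strict_mono f" "(\<lambda>n. sgn (x (f n))) \<longlonglongrightarrow> l"
    using bounded_convergent_subseq[of "\<lambda>n. sgn (x n)" 1] x0 by (metis order_refl)
  have "l \<in> L" using lim f by blast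
  have l1: "norm l = 1"
    using tendsto_norm[OF f(2)] x0 by (simp add: LIMSEQ_const_iff)
  have "norm (orth_proj L (sgn (x n))) \<le> 1/2" for n
  proof -
    have "norm (x n) > 0" using x0[of n] by (metis norm_zero sgn_zero zero_less_norm_iff zero_neq_one)
    then show ?thesis using x[of n]
      by (simp add: sgn_div_norm P.scaleR field_simps)
  qed
  moreover have "(\<lambda>n. norm (orth_proj L (sgn (x (f n))))) \<longlonglongrightarrow> norm (orth_proj L l)"
    by (intro tendsto_norm P.tendsto f)
  ultimately have "norm (orth_proj L l) \<le> 1/2"
    by (meson LIMSEQ_le_const2)
  with orth_proj_id[OF L \<open>l \<in> L\<close>] l1 show False by simp
qed

section \<open>Sequential convergence of closed sets\<close>

text \<open>Wijsman convergence, which for nonempty closed sets in finite dimension is sequential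
  Fell convergence. Since \<open>infdist x {} = 0\<close>, it is meaningful only for nonempty
  sets.\<close>

definition set_converges :: "(nat \<Rightarrow> 'a::metric_space set) \<Rightarrow> 'a set \<Rightarrow> bool" where
  "set_converges A B \<longleftrightarrow> (\<forall>x. (\<lambda>n. infdist x (A n)) \<longlonglongrightarrow> infdist x B)"

lemma set_converges_const: "set_converges (\<lambda>n. A) A"
  by (simp add: set_converges_def)

lemma set_converges_subseq:
  "set_converges A B \<Longrightarrow> strict_mono f \<Longrightarrow> set_converges (\<lambda>n. A (f n)) B"
  using LIMSEQ_subseq_LIMSEQ[of "\<lambda>n. infdist _ (A n)"] by (simp add: set_converges_def o_def)

text \<open>The upper half of Kuratowski convergence; \<open>set_converges_approx\<close> is the
  lower half, realised by nearest points.\<close>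

lemma set_converges_limit:
  assumes "set_converges A B" "closed B" "B \<noteq> {}" "\<And>n. x n \<in> A n" "x \<longlonglongrightarrow> l"
  shows "l \<in> B"
proof -
  have "(\<lambda>n. dist l (x n)) \<longlonglongrightarrow> 0"
    using tendsto_dist[OF tendsto_const[of l] assms(5)] by simp
  then have "(\<lambda>n. infdist l (A n)) \<longlonglongrightarrow> 0"
    by (rule Lim_null_comparison[rotated]) (auto simp: infdist_nonneg intro!: always_eventually infdist_le assms(4))
  moreover have "(\<lambda>n. infdist l (A n)) \<longlonglongrightarrow> infdist l B"
    using assms(1) by (simp add: set_converges_def)
  ultimately have "infdist l B = 0" using LIMSEQ_unique by blast
  then show ?thesis using assms in_closed_iff_infdist_zero by blast
qed

lemma infdist_null_approx:
  fixes A :: "nat \<Rightarrow> 'a::heine_borel set"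
  assumes "\<And>n. closed (A n)" "\<And>n. A n \<noteq> {}" "(\<lambda>n. infdist b (A n)) \<longlonglongrightarrow> 0"
  obtains x where "\<And>n. x n \<in> A n" "x \<longlonglongrightarrow> b"
proof -
  have "\<forall>n. \<exists>y\<in>A n. infdist b (A n) = dist b y"
    using assms infdist_attains_inf by metis
  then obtain x where x: "\<And>n. x n \<in> A n" "\<And>n. infdist b (A n) = dist b (x n)" by metis
  then have "(\<lambda>n. dist (x n) b) \<longlonglongrightarrow> 0" using assms(3) by (simp add: dist_commute)
  then have "x \<longlonglongrightarrow> b" using tendsto_dist_iff by blast
  with x that show ?thesis by blast
qed

lemma set_converges_approx:
  fixes A :: "nat \<Rightarrow> 'a::heine_borel set"
  assumes "set_converges A B" "\<And>n. closed (A n)" "\<And>n. A n \<noteq> {}" "b \<in> B"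
  obtains x where "\<And>n. x n \<in> A n" "x \<longlonglongrightarrow> b"
proof (rule infdist_null_approx[OF assms(2,3)])
  show "(\<lambda>n. infdist b (A n)) \<longlonglongrightarrow> 0"
    using assms(1,4) unfolding set_converges_def by (metis infdist_zero)
qed (use that in auto)

section \<open>The Fell topology through distance functions\<close>

lemma topspace_fell: "topspace fell_topology = {A. closed A}"
proof -
  \<comment> \<open>The empty compact set contributes the whole power set to the subbasis, so the
    generated topology has full carrier before it is cut down to closed sets.\<close>
  have "UNIV \<in> {{A::'a set. A \<inter> U \<noteq> {}} | U. open U} \<union> {{A. A \<inter> K = {}} | K. compact K}"
    by (rule UnI2) (use compact_empty in blast)
  then show ?thesis
    unfolding fell_topology_def topspace_subtopology topology_generated_by_topspace by blast
qed

text \<open>Because distances to closed sets are attained, being nearer than \<open>a\<close> means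
  hitting an open ball, and being farther means missing a compact ball: both are subbasic
  conditions.\<close>

lemma continuous_map_infdist_fell:
  fixes x :: "'a::euclidean_space"
  shows "continuous_map (subtopology fell_topology {A. A \<noteq> {}}) euclideanreal (infdist x)"
  unfolding continuous_map_upper_lower_semicontinuous_lt
proof (intro conjI allI)
  let ?X = "subtopology fell_topology {A::'a set. A \<noteq> {}}"
  let ?G = "{{A::'a set. A \<inter> U \<noteq> {}} | U. open U} \<union> {{A. A \<inter> K = {}} | K. compact K}"
  have top: "topspace ?X = {A. closed A \<and> A \<noteq> {}}" by (auto simp: topspace_fell)
  have op: "openin ?X (N \<inter> {A. closed A} \<inter> {A. A \<noteq> {}})" if "N \<in> ?G" for N
    unfolding fell_topology_def openin_subtopology
    using topology_generated_by_Basis[OF that] by blast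
  fix a :: real
  have "{A \<in> topspace ?X. infdist x A < a} = {A. A \<inter> ball x a \<noteq> {}} \<inter> {A. closed A} \<inter> {A. A \<noteq> {}}"
  proof -
    have "infdist x A < a \<longleftrightarrow> A \<inter> ball x a \<noteq> {}" if A: "closed A" "A \<noteq> {}" for A :: "'a set"
    proof
      assume "infdist x A < a"
      moreover obtain y where "y \<in> A" "infdist x A = dist x y"
        using infdist_attains_inf[OF A] by blast
      ultimately show "A \<inter> ball x a \<noteq> {}" by auto
    next
      assume "A \<inter> ball x a \<noteq> {}"
      then obtain y where "y \<in> A" "dist x y < a" by auto
      then show "infdist x A < a" using infdist_le order_le_less_trans by blast
    qed
    then show ?thesis unfolding top by blast
  qed
  moreover have "{A. A \<inter> ball x a \<noteq> {}} \<in> ?G" using open_ball by blast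
  ultimately show "openin ?X {A \<in> topspace ?X. infdist x A < a}" by (metis (lifting) op)
  have "{A \<in> topspace ?X. infdist x A > a} = {A. A \<inter> cball x a = {}} \<inter> {A. closed A} \<inter> {A. A \<noteq> {}}"
  proof -
    have "infdist x A > a \<longleftrightarrow> A \<inter> cball x a = {}" if A: "closed A" "A \<noteq> {}" for A :: "'a set"
    proof
      assume "infdist x A > a"
      then show "A \<inter> cball x a = {}"
        using infdist_le[of _ A x] by (force simp: disjoint_iff not_le)
    next
      assume "A \<inter> cball x a = {}"
      moreover obtain y where "y \<in> A" "infdist x A = dist x y"
        using infdist_attains_inf[OF A] by blast
      ultimately show "infdist x A > a" by (force simp: disjoint_iff not_le)
    qed
    then show ?thesis unfolding top by blast
  qed
  moreover have "{A. A \<inter> cball x a = {}} \<in> ?G" using compact_cball by blast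
  ultimately show "openin ?X {A \<in> topspace ?X. infdist x A > a}" by (metis (lifting) op)
qed

definition dense_seq :: "nat \<Rightarrow> 'a::euclidean_space" where
  "dense_seq = (SOME q. \<forall>x. \<forall>e>0. \<exists>n. dist x (q n) < e)"

lemma dense_seq: "0 < e \<Longrightarrow> \<exists>n. dist x (dense_seq n) < e"
proof -
  obtain D :: "'a set" where D: "countable D" "\<And>X. open X \<Longrightarrow> X \<noteq> {} \<Longrightarrow> \<exists>d\<in>D. d \<in> X"
    using countable_dense_setE by blast
  then have "D \<noteq> {}" using open_UNIV by blast
  have "\<exists>n. dist x (from_nat_into D n) < e" if e: "0 < e" for x e
  proof -
    obtain d where "d \<in> D" "d \<in> ball x e"
      using D(2)[of "ball x e"] e by auto
    then show ?thesis
      using from_nat_into_surj[OF D(1)] by (metis mem_ball)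
  qed
  then have "\<exists>q::nat \<Rightarrow> 'a. \<forall>x. \<forall>e>0. \<exists>n. dist x (q n) < e" by blast
  from someI_ex[OF this] show "0 < e \<Longrightarrow> \<exists>n. dist x (dense_seq n) < e"
    by (simp add: dense_seq_def)
qed

text \<open>Sends closed sets into the metrisable product of countably many lines. Distances to a
  dense sequence control all others because \<open>infdist\<close> is 1-Lipschitz in the
  point.\<close>

definition dist_seq :: "'a::euclidean_space set \<Rightarrow> nat \<Rightarrow> real" where
  "dist_seq A n = infdist (dense_seq n) A"

lemma continuous_map_dist_seq:
  "continuous_map (subtopology fell_topology {A. A \<noteq> {}}) euclidean dist_seq"
proof -
  have "continuous_map (subtopology fell_topology {A. A \<noteq> {}})
      (product_topology (\<lambda>i. euclideanreal) UNIV) dist_seq"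
    unfolding continuous_map_componentwise_UNIV dist_seq_def
    by (simp add: continuous_map_infdist_fell)
  then show ?thesis by (simp add: euclidean_product_topology)
qed

lemma set_converges_dist_seqI:
  assumes "(\<lambda>n. dist_seq (A n)) \<longlonglongrightarrow> dist_seq B"
  shows "set_converges A B"
  unfolding set_converges_def
proof
  fix x
  show "(\<lambda>n. infdist x (A n)) \<longlonglongrightarrow> infdist x B"
  proof (rule metric_LIMSEQ_I)
    fix e :: real assume "0 < e"
    then obtain k where k: "dist x (dense_seq k) < e / 3"
      using dense_seq[of "e/3" x] by auto
    have "(\<lambda>n. dist_seq (A n) k) \<longlonglongrightarrow> dist_seq B k"
    proof -
      have "continuous_on UNIV (\<lambda>y::nat \<Rightarrow> real. y k)" by simp
      from continuous_on_tendsto_compose[OF this assms] show ?thesis by simp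
    qed
    then obtain N where N: "\<And>n. n \<ge> N \<Longrightarrow> dist (dist_seq (A n) k) (dist_seq B k) < e / 3"
      using metric_LIMSEQ_D[of _ _ "e/3"] \<open>0 < e\<close> by force
    have "dist (infdist x (A n)) (infdist x B) < e" if "n \<ge> N" for n
      using N[OF that, unfolded dist_seq_def dist_real_def]
        infdist_triangle_abs[of x "A n" "dense_seq k"] infdist_triangle_abs[of x B "dense_seq k"] k
      unfolding dist_real_def by linarith
    then show "\<exists>N. \<forall>n\<ge>N. dist (infdist x (A n)) (infdist x B) < e" by blast
  qed
qed

text \<open>\<open>dist_seq\<close> carries Fell compactness to compactness in a metric space, where
  subsequences converge. The limit lies in the image, so it is the distance sequence of a member of
  \<open>P\<close>.\<close>

lemma compactin_fell_convergent_subseq: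
  fixes A :: "nat \<Rightarrow> 'a::euclidean_space set"
  assumes "compactin fell_topology P" "{} \<notin> P" "\<And>n. A n \<in> P"
  obtains f :: "nat \<Rightarrow> nat" and B where "strict_mono f" "B \<in> P" "set_converges (\<lambda>n. A (f n)) B"
proof -
  have "compactin (subtopology fell_topology {A. A \<noteq> {}}) P"
    using assms(1,2) by (auto simp: compactin_subtopology)
  then have "compactin euclidean (dist_seq ` P)"
    by (rule image_compactin[OF _ continuous_map_dist_seq])
  then have "seq_compact (dist_seq ` P)"
    using compact_imp_seq_compact by simp
  then obtain l f where l: "l \<in> dist_seq ` P" "strict_mono f" "((\<lambda>n. dist_seq (A n)) \<circ> f) \<longlonglongrightarrow> l"
    using seq_compactE[of _ "\<lambda>n. dist_seq (A n)"] assms(3) by blast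
  then obtain B where "B \<in> P" "l = dist_seq B" by blast
  with l that show ?thesis using set_converges_dist_seqI[of "\<lambda>n. A (f n)" B] by (simp add: o_def)
qed

text \<open>Counterexamples taken from the preimages of balls of radius 1/(k+1) converge to
  \<open>b\<close>. The index in \<open>Q k\<close> lets a second radius, around a vector, shrink
  together with the neighbourhood of \<open>b\<close>.\<close>

lemma fell_neighbourhood_via_sequences:
  assumes "B \<subseteq> {A. closed A \<and> A \<noteq> {}}" "b \<in> B"
    and "\<And>s. (\<And>k. s k \<in> B) \<Longrightarrow> set_converges s b \<Longrightarrow> \<exists>k. Q k (s k)"
  obtains k N where "openin (subtopology fell_topology B) N" "b \<in> N" "\<And>A. A \<in> N \<Longrightarrow> Q k A"
proof -
  let ?T = "subtopology fell_topology B"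
  define N where "N k = {A \<in> topspace ?T. dist_seq A \<in> ball (dist_seq b) (inverse (real (Suc k)))}" for k
  have top: "topspace ?T = B" using assms(1) by (auto simp: topspace_fell)
  have cont: "continuous_map ?T euclidean dist_seq"
    using continuous_map_from_subtopology_mono[OF continuous_map_dist_seq, of B] assms(1) by blast
  have op: "openin ?T (N k)" for k
    unfolding N_def by (rule openin_continuous_map_preimage[OF cont]) simp
  have bN: "b \<in> N k" for k using assms(2) by (auto simp: N_def top simp del: topspace_subtopology)
  have "\<exists>k. \<forall>A\<in>N k. Q k A"
  proof (rule ccontr)
    assume "\<not> ?thesis"
    then obtain s where s: "\<And>k. s k \<in> N k" "\<And>k. \<not> Q k (s k)" by metis
    have "(\<lambda>k. dist_seq (s k)) \<longlonglongrightarrow> dist_seq b"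
    proof (rule metric_LIMSEQ_I)
      fix e :: real assume "0 < e"
      then obtain M where M: "inverse (real (Suc M)) < e" using reals_Archimedean by blast
      have "dist (dist_seq (s n)) (dist_seq b) < e" if "n \<ge> M" for n
      proof -
        have "dist (dist_seq (s n)) (dist_seq b) < inverse (real (Suc n))"
          using s(1)[of n] by (simp add: N_def dist_commute)
        also have "\<dots> \<le> inverse (real (Suc M))" using that by (simp add: field_simps)
        finally show ?thesis using M by linarith
      qed
      then show "\<exists>M. \<forall>n\<ge>M. dist (dist_seq (s n)) (dist_seq b) < e" by blast
    qed
    then have "set_converges s b" by (rule set_converges_dist_seqI)
    moreover have "s k \<in> B" for k using s(1)[of k] by (auto simp: N_def top simp del: topspace_subtopology)
    ultimately show False using assms(3)[of s] s(2) by blast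
  qed
  then show ?thesis using that op bN by blast
qed

section \<open>Normals to faces\<close>

lemma subspace_orth: "subspace (orth A)"
  by (auto simp: orth_def subspace_def inner_add_left)

definition contact_face :: "'a::euclidean_space set \<Rightarrow> 'a \<Rightarrow> 'a set" where
  "contact_face E g = {z \<in> E. g \<bullet> z = 0}"

text \<open>\<open>S\<close> need not lie in \<open>V\<close>; its orthogonal complement is too
  large to meet \<open>V\<close> only in 0.\<close>

lemma ex_unit_orthogonal:
  fixes V S :: "'a::euclidean_space set"
  assumes "subspace V" "subspace S" "dim S < dim V"
  shows "\<exists>w\<in>V. norm w = 1 \<and> (\<forall>s\<in>S. w \<bullet> s = 0)"
proof -
  let ?O = "{y \<in> UNIV. \<forall>x\<in>S. orthogonal x y}"
  have O: "subspace ?O" by (auto simp: subspace_def orthogonal_clauses)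
  have "dim ?O + dim S = DIM('a)"
    using dim_subspace_orthogonal_to_vectors[of S UNIV] assms by simp
  moreover have "dim {x + y |x y. x \<in> V \<and> y \<in> ?O} + dim (V \<inter> ?O) = dim V + dim ?O"
    by (rule dim_sums_Int[OF assms(1) O])
  moreover have "dim {x + y |x y. x \<in> V \<and> y \<in> ?O} \<le> DIM('a)" by (rule dim_subset_UNIV)
  ultimately have "dim (V \<inter> ?O) > 0" using assms(3) by linarith
  then have "\<not> V \<inter> ?O \<subseteq> {0}" by (metis dim_eq_0 less_numeral_extra(3))
  then obtain w where w: "w \<in> V" "w \<in> ?O" "w \<noteq> 0" by blast
  then have "sgn w \<in> V" using assms(1) by (simp add: sgn_div_norm subspace_scale)
  moreover have "norm (sgn w) = 1" using w by (simp add: norm_sgn)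
  moreover have "\<forall>s\<in>S. sgn w \<bullet> s = 0"
    using w by (auto simp: sgn_div_norm orthogonal_def inner_commute)
  ultimately show ?thesis by blast
qed

text \<open>The first-order condition at a local minimiser: along the segment to \<open>y\<close>
  the objective is exactly quadratic in t, so its slope appears after division by t and t tending to
  0. The vector on the left is the gradient of the objective at \<open>z\<close>.\<close>

lemma quadratic_min_variational:
  fixes A :: "'a::euclidean_space set"
  assumes "convex A" "z \<in> A" "0 < \<epsilon>" "y \<in> A"
    and min: "\<And>z'. z' \<in> A \<Longrightarrow> dist z z' < \<epsilon> \<Longrightarrow>
      a \<bullet> z + (1/2) * (\<Sum>f\<in>B. ((z - x) \<bullet> c f)\<^sup>2) \<le> a \<bullet> z' + (1/2) * (\<Sum>f\<in>B. ((z' - x) \<bullet> c f)\<^sup>2)"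
  shows "0 \<le> (a + (\<Sum>f\<in>B. ((z - x) \<bullet> c f) *\<^sub>R c f)) \<bullet> (y - z)"
proof -
  let ?d = "y - z"
  let ?G = "a + (\<Sum>f\<in>B. ((z - x) \<bullet> c f) *\<^sub>R c f)"
  let ?S = "\<Sum>f\<in>B. (?d \<bullet> c f)\<^sup>2"
  have exp: "a \<bullet> (z + t *\<^sub>R ?d) + (1/2) * (\<Sum>f\<in>B. ((z + t *\<^sub>R ?d - x) \<bullet> c f)\<^sup>2)
      = a \<bullet> z + (1/2) * (\<Sum>f\<in>B. ((z - x) \<bullet> c f)\<^sup>2) + t * (?G \<bullet> ?d + (t / 2) * ?S)" for t
  proof -
    have "((z + t *\<^sub>R ?d - x) \<bullet> c f)\<^sup>2
        = ((z - x) \<bullet> c f)\<^sup>2 + 2 * t * (((z - x) \<bullet> c f) * (c f \<bullet> ?d)) + t\<^sup>2 * (?d \<bullet> c f)\<^sup>2" for f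
    proof -
      have "(z + t *\<^sub>R ?d - x) \<bullet> c f = (z - x) \<bullet> c f + t * (?d \<bullet> c f)"
        by (simp add: algebra_simps)
      then show ?thesis by (simp add: power2_eq_square algebra_simps inner_commute)
    qed
    then have "(\<Sum>f\<in>B. ((z + t *\<^sub>R ?d - x) \<bullet> c f)\<^sup>2) = (\<Sum>f\<in>B. ((z - x) \<bullet> c f)\<^sup>2)
        + 2 * t * (\<Sum>f\<in>B. ((z - x) \<bullet> c f) * (c f \<bullet> ?d)) + t\<^sup>2 * ?S"
      by (simp add: sum.distrib sum_distrib_left)
    moreover have "?G \<bullet> ?d = a \<bullet> ?d + (\<Sum>f\<in>B. ((z - x) \<bullet> c f) * (c f \<bullet> ?d))"
      by (simp add: inner_add_left inner_sum_left)
    ultimately show ?thesis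
      by (simp only: inner_add_right inner_scaleR_right power2_eq_square) (simp add: algebra_simps)
  qed
  \<comment> \<open>The bound 1 keeps the point on the segment, the other keeps it within \<epsilon>
    of \<open>z\<close>; the summand 1 avoids a zero denominator when \<open>y = z\<close>.\<close>
  define \<delta> where "\<delta> = min 1 (\<epsilon> / (norm ?d + 1))"
  have "0 < \<delta>" using assms(3) by (auto simp: \<delta>_def intro!: divide_pos_pos add_nonneg_pos)
  have "0 \<le> ?G \<bullet> ?d + (t / 2) * ?S" if t: "0 < t" "t < \<delta>" for t
  proof -
    have "(1 - t) *\<^sub>R z + t *\<^sub>R y \<in> A"
      by (rule convexD[OF assms(1,2,4)]) (use t in \<open>auto simp: \<delta>_def\<close>)
    then have 1: "z + t *\<^sub>R ?d \<in> A" by (simp add: algebra_simps)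
    have "t * (norm ?d + 1) < \<epsilon>"
      using t by (simp add: \<delta>_def pos_less_divide_eq add_nonneg_pos)
    then have "dist z (z + t *\<^sub>R ?d) < \<epsilon>" using t by (simp add: dist_norm distrib_left)
    from min[OF 1 this] have "0 \<le> t * (?G \<bullet> ?d + (t / 2) * ?S)" unfolding exp by linarith
    then show ?thesis using t(1) by (metis zero_le_mult_iff not_less)
  qed
  then have "\<forall>\<^sub>F t in at_right 0. 0 \<le> ?G \<bullet> ?d + (t / 2) * ?S"
    using eventually_at_right_less \<open>0 < \<delta>\<close> by (auto simp: eventually_at_right_field)
  moreover have "((\<lambda>t. ?G \<bullet> ?d + (t / 2) * ?S) \<longlongrightarrow> ?G \<bullet> ?d + (0 / 2) * ?S) (at_right 0)"
    by (intro tendsto_intros) simp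
  ultimately show ?thesis
    using tendsto_lowerbound by fastforce
qed

section \<open>Faces, their spans and their normals under sequential limits\<close>

locale face_gap =
  fixes C :: "'a::euclidean_space set" and r m :: nat
  assumes closed_C: "closed C" and convex_C: "convex C" and cone_C: "cone C"
    and faces_compact: "\<And>H s. (\<And>n. H n \<in> faces C) \<Longrightarrow> (\<And>n. dim (H n) = s) \<Longrightarrow>
      \<exists>(f::nat \<Rightarrow> nat) A. strict_mono f \<and> A \<in> faces C \<and> dim A = s \<and> set_converges (\<lambda>n. H (f n)) A"
    and m_less: "m < r"
    and gap: "\<And>G. G \<in> faces C \<Longrightarrow> dim G < r \<Longrightarrow> dim G \<le> m"
begin

lemma face_props:
  assumes "E \<in> faces C"
  shows "closed E" "convex E" "0 \<in> E" "x \<in> E \<Longrightarrow> 0 \<le> c \<Longrightarrow> c *\<^sub>R x \<in> E" "E \<subseteq> C" "E \<noteq> {}"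
proof -
  have E: "E face_of C" "E \<noteq> {}" using assms by (auto simp: faces_def)
  show "closed E" using face_of_imp_closed[OF convex_C closed_C E(1)] .
  show "convex E" using face_of_imp_convex[OF E(1)] .
  have "conic C" using cone_C by (auto simp: conic_def cone_def)
  then have con: "conic E" using face_of_conic E by blast
  then show *: "x \<in> E \<Longrightarrow> 0 \<le> c \<Longrightarrow> c *\<^sub>R x \<in> E" for x c by (auto simp: conic_def)
  show "0 \<in> E" using E(2) *[of _ 0] by auto
  show "E \<subseteq> C" using E face_of_imp_subset by blast
  show "E \<noteq> {}" by (rule E(2))
qed

lemma face_dim_less:
  assumes "E \<in> faces C" "G \<in> faces C" "G \<subseteq> E" "G \<noteq> E"
  shows "dim G < dim E"
proof -
  have "G face_of E"
    using assms face_props(5)[OF assms(1)] face_of_subset[of G C E] by (simp add: faces_def)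
  then have "aff_dim G < aff_dim E"
    using face_of_aff_dim_lt face_props(2) assms by blast
  \<comment> \<open>Faces of the cone contain 0, so affine and linear dimension agree.\<close>
  then show ?thesis
    using aff_dim_zero[OF hull_inc] face_props(3) assms by (metis of_nat_less_iff)
qed

lemma contact_face_in_faces:
  assumes "E \<in> faces C" "\<And>z. z \<in> E \<Longrightarrow> 0 \<le> g \<bullet> z"
  shows "contact_face E g \<in> faces C"
proof -
  have "E \<inter> {z. g \<bullet> z = 0} face_of E"
    using face_of_Int_supporting_hyperplane_ge face_props(2) assms by blast
  then have "contact_face E g face_of E"
    by (simp add: contact_face_def Int_def)
  moreover have "0 \<in> contact_face E g" using face_props(3) assms by (simp add: contact_face_def)
  ultimately show ?thesis using assms(1) by (auto simp: faces_def intro: face_of_trans)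
qed

text \<open>A nonzero \<open>g\<close> in the span of \<open>E\<close> cannot vanish on all of
  \<open>E\<close>, since it would be orthogonal to itself. The contact face is therefore proper,
  and \<open>gap\<close> applies.\<close>

lemma contact_face_dim_le:
  assumes "E \<in> faces C" "dim E = r" "\<And>z. z \<in> E \<Longrightarrow> 0 \<le> g \<bullet> z" "g \<in> span E" "g \<noteq> 0"
  shows "dim (contact_face E g) \<le> m"
proof -
  have "contact_face E g \<noteq> E"
  proof
    assume "contact_face E g = E"
    then have "\<forall>z\<in>E. orthogonal g z" by (auto simp: contact_face_def orthogonal_def)
    then have "orthogonal g g" using orthogonal_to_span assms(4) by blast
    with assms(5) show False by (simp add: orthogonal_self)
  qed
  then have "dim (contact_face E g) < r"
    using face_dim_less contact_face_in_faces assms contact_face_def by blast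
  then show ?thesis using gap contact_face_in_faces assms by blast
qed

text \<open>For a face of dimension r, m is the largest possible dimension of a contact face of a
  nonzero normal. The dimension condition excludes 0, whose contact face is all of
  \<open>E\<close>.\<close>

definition normals :: "'a set \<Rightarrow> 'a set" where
  "normals E = {g \<in> span E. (\<forall>z\<in>E. 0 \<le> g \<bullet> z) \<and> dim (contact_face E g) = m}"

definition fconv :: "(nat \<Rightarrow> 'a set) \<Rightarrow> 'a set \<Rightarrow> bool" where
  "fconv A E \<longleftrightarrow> (\<forall>n. A n \<in> faces C \<and> dim (A n) = r) \<and> E \<in> faces C \<and> dim E = r \<and> set_converges A E"

lemma fconvD:
  assumes "fconv A E"
  shows "A n \<in> faces C" "dim (A n) = r" "E \<in> faces C" "dim E = r" "set_converges A E"
  using assms by (auto simp: fconv_def)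

lemma fconv_const: "E \<in> faces C \<Longrightarrow> dim E = r \<Longrightarrow> fconv (\<lambda>n. E) E"
  by (simp add: fconv_def set_converges_const)

lemma fconv_subseq: "fconv A E \<Longrightarrow> strict_mono f \<Longrightarrow> fconv (\<lambda>n. A (f n)) E"
  by (simp add: fconv_def set_converges_subseq)

lemma fconv_limit:
  assumes "fconv A E" "\<And>n. x n \<in> A n" "x \<longlonglongrightarrow> l"
  shows "l \<in> E"
  using set_converges_limit[OF fconvD(5)[OF assms(1)]] face_props[OF fconvD(3)[OF assms(1)]] assms by blast

lemma fconv_approx:
  assumes "fconv A E" "b \<in> E"
  obtains x where "\<And>n. x n \<in> A n" "x \<longlonglongrightarrow> b"
  using set_converges_approx[OF fconvD(5)[OF assms(1)]] face_props[OF fconvD(1)[OF assms(1)]] assms(2)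
  by metis

text \<open>The vectors that can be approximated form a subspace containing
  \<open>E\<close>.\<close>

lemma span_approx:
  assumes "fconv A E" "v \<in> span E"
  obtains s where "\<And>n. s n \<in> span (A n)" "s \<longlonglongrightarrow> v"
proof -
  let ?L = "{x. \<exists>s. (\<forall>n. s n \<in> span (A n)) \<and> s \<longlonglongrightarrow> x}"
  have "subspace ?L"
  proof (rule subspaceI)
    show "0 \<in> ?L" by (auto intro!: exI[of _ "\<lambda>n. 0"] span_zero)
  next
    fix x y assume "x \<in> ?L" "y \<in> ?L"
    then obtain s t where "\<forall>n. s n \<in> span (A n)" "s \<longlonglongrightarrow> x" "\<forall>n. t n \<in> span (A n)" "t \<longlonglongrightarrow> y" by blast
    then show "x + y \<in> ?L"
      by (auto intro!: exI[of _ "\<lambda>n. s n + t n"] span_add tendsto_add)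
  next
    fix c x assume "x \<in> ?L"
    then obtain s where "\<forall>n. s n \<in> span (A n)" "s \<longlonglongrightarrow> x" by blast
    then show "c *\<^sub>R x \<in> ?L"
      by (auto intro!: exI[of _ "\<lambda>n. c *\<^sub>R s n"] span_scale tendsto_scaleR)
  qed
  moreover have "E \<subseteq> ?L"
  proof
    fix x assume "x \<in> E"
    then obtain s where "\<And>n. s n \<in> A n" "s \<longlonglongrightarrow> x" using fconv_approx assms(1) by metis
    then show "x \<in> ?L" using span_base by blast
  qed
  ultimately have "span E \<subseteq> ?L" by (simp add: span_minimal)
  with assms(2) that show ?thesis by blast
qed

text \<open>A limit direction outside the span would give, by counting dimensions, unit vectors orthogonal
  to all the approximating spans yet converging to a limit of elements of these spans.\<close>
lemma span_limit:
  assumes A: "fconv A E" and v: "\<And>n. v n \<in> span (A n)" "v \<longlonglongrightarrow> l"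
  shows "l \<in> span E"
proof (rule ccontr)
  assume l: "l \<notin> span E"
  let ?V = "span (insert l E)"
  have "dim ?V = Suc r" using l fconvD[OF A] by (simp add: dim_insert)
  then have "\<forall>n. \<exists>w\<in>?V. norm w = 1 \<and> (\<forall>s\<in>span (A n). w \<bullet> s = 0)"
    using ex_unit_orthogonal[OF subspace_span subspace_span, of "A _" "insert l E"] fconvD(2)[OF A]
    by simp
  then obtain w where w: "\<And>n. w n \<in> ?V" "\<And>n. norm (w n) = 1" "\<And>n s. s \<in> span (A n) \<Longrightarrow> w n \<bullet> s = 0"
    by metis
  obtain f w' where f: "strict_mono f" "(\<lambda>n. w (f n)) \<longlonglongrightarrow> w'"
    using bounded_convergent_subseq[of w 1] w(2) by (metis order_refl)
  have "w' \<in> ?V" by (rule closed_sequentially[OF closed_subspace[OF subspace_span] w(1) f(2)])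
  then obtain k where k: "w' - k *\<^sub>R l \<in> span E" unfolding span_insert by blast
  define x where "x = w' - k *\<^sub>R l"
  have x: "w' = x + k *\<^sub>R l" "x \<in> span E" using k by (auto simp: x_def)
  obtain s where s: "\<And>n. s n \<in> span (A n)" "s \<longlonglongrightarrow> x" using span_approx[OF A x(2)] by blast
  have "(\<lambda>n. s n + k *\<^sub>R v n) \<longlonglongrightarrow> w'" unfolding x(1) by (intro tendsto_intros s v)
  from LIMSEQ_subseq_LIMSEQ[OF this f(1)]
  have "(\<lambda>n. w (f n) \<bullet> (s (f n) + k *\<^sub>R v (f n))) \<longlonglongrightarrow> w' \<bullet> w'"
    by (intro tendsto_inner f) (simp add: o_def)
  moreover have "w (f n) \<bullet> (s (f n) + k *\<^sub>R v (f n)) = 0" for n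
    by (intro w(3) span_add span_scale s v)
  ultimately have "w' \<bullet> w' = 0" by (simp add: LIMSEQ_const_iff)
  moreover have "norm w' = 1" using tendsto_norm[OF f(2)] by (simp add: w LIMSEQ_const_iff)
  ultimately show False by simp
qed

text \<open>Unit vectors of the spans accumulate only in the span of \<open>E\<close>. Hence the
  projection is eventually injective on the approximating spans, with inverse of norm at most
  2.\<close>

lemma span_proj_lower:
  assumes A: "fconv A E"
  shows "\<forall>\<^sub>F n in sequentially. \<forall>s\<in>span (A n). norm s \<le> 2 * norm (orth_proj (span E) s)"
proof (rule eventually_sequentially_via_subseq, rule ccontr)
  fix f :: "nat \<Rightarrow> nat" assume f: "strict_mono f"
    and no: "\<nexists>n. \<forall>s\<in>span (A (f n)). norm s \<le> 2 * norm (orth_proj (span E) s)"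
  then obtain s where s: "\<And>n. s n \<in> span (A (f n))" "\<And>n. 2 * norm (orth_proj (span E) (s n)) < norm (s n)"
    by (meson not_le)
  show False
  proof (rule sgn_limit_contradiction[OF subspace_span s(2)])
    fix h l assume h: "strict_mono h" "(\<lambda>n. sgn (s (h n))) \<longlonglongrightarrow> l"
    show "l \<in> span E"
    proof (rule span_limit[OF fconv_subseq[OF fconv_subseq[OF A f] h(1)] _ h(2)])
      show "sgn (s (h n)) \<in> span (A (f (h n)))" for n
        using s(1) by (simp add: sgn_div_norm span_scale)
    qed
  qed
qed

text \<open>For equal dimensions the injective projection is onto, and \<open>a n\<close> is the
  preimage of \<open>y n\<close>. Inner products with the span of \<open>E\<close> are thereby kept
  exactly and not only in the limit, which later makes the coordinates of constructed normals
  exact.\<close>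

lemma span_lift:
  assumes A: "fconv A E" and y: "\<And>n. y n \<in> span E" "y \<longlonglongrightarrow> l"
  obtains a where "\<And>n. a n \<in> span (A n)" "a \<longlonglongrightarrow> l" "\<forall>\<^sub>F n in sequentially. \<forall>t\<in>span E. a n \<bullet> t = y n \<bullet> t"
proof -
  let ?P = "orth_proj (span E)"
  interpret P: bounded_linear ?P by (rule bounded_linear_orth_proj[OF subspace_span])
  let ?low = "\<lambda>n. \<forall>s\<in>span (A n). norm s \<le> 2 * norm (?P s)"
  have surj: "?P ` span (A n) = span E" if "?low n" for n
  proof (rule subspace_dim_equal)
    have "inj_on ?P (span (A n))"
    proof (rule inj_onI)
      fix s t assume "s \<in> span (A n)" "t \<in> span (A n)" "?P s = ?P t"
      then have "s - t \<in> span (A n)" "?P (s - t) = 0" by (auto simp: span_diff P.diff)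
      with that show "s = t" by fastforce
    qed
    then have "dim (?P ` span (A n)) = dim (span (A n))"
      using dim_image_eq[of ?P "span (A n)"] P.linear unfolding span_span by blast
    then show "dim (span E) \<le> dim (?P ` span (A n))" using fconvD[OF A] by simp
    show "subspace (?P ` span (A n))" by (rule linear_subspace_image[OF P.linear subspace_span])
  qed (auto simp: orth_proj[OF subspace_span])
  \<comment> \<open>At indices where the bound still fails, 0 is an admissible choice.\<close>
  have "\<exists>a. a \<in> span (A n) \<and> (?low n \<longrightarrow> ?P a = y n)" for n
    using surj[of n] y(1)[of n] span_zero by (metis imageE)
  then obtain a where a: "\<And>n. a n \<in> span (A n)" "\<And>n. ?low n \<Longrightarrow> ?P (a n) = y n" by metis
  have l: "l \<in> span E"
    by (rule closed_sequentially[OF closed_subspace[OF subspace_span] y])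
  obtain s where s: "\<And>n. s n \<in> span (A n)" "s \<longlonglongrightarrow> l" using span_approx[OF A l] by blast
  have "(\<lambda>n. 2 * norm (y n - ?P (s n))) \<longlonglongrightarrow> 2 * norm (l - ?P l)"
    by (intro tendsto_intros y P.tendsto s)
  then have "(\<lambda>n. 2 * norm (y n - ?P (s n))) \<longlonglongrightarrow> 0"
    using orth_proj_id[OF subspace_span l] by simp
  then have "(\<lambda>n. a n - s n) \<longlonglongrightarrow> 0"
  proof (rule Lim_null_comparison[rotated])
    show "\<forall>\<^sub>F n in sequentially. norm (a n - s n) \<le> 2 * norm (y n - ?P (s n))"
      using span_proj_lower[OF A]
    proof eventually_elim
      case (elim n)
      then have "norm (a n - s n) \<le> 2 * norm (?P (a n - s n))" using a(1) s(1) span_diff by blast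
      then show ?case using a(2)[OF elim] by (simp add: P.diff)
    qed
  qed
  from tendsto_add[OF this s(2)] have "a \<longlonglongrightarrow> l" by simp
  moreover have "\<forall>\<^sub>F n in sequentially. \<forall>t\<in>span E. a n \<bullet> t = y n \<bullet> t"
    using span_proj_lower[OF A] by eventually_elim (use a(2) orth_proj(2)[OF subspace_span] in metis)
  ultimately show ?thesis using that a(1) by blast
qed

text \<open>A limit \<open>G\<close> of the contact faces has dimension m and lies in the contact
  face of \<open>l\<close>, whose dimension is at most m because \<open>l\<close> is nonzero. Nested
  faces of equal dimension coincide.\<close>

lemma normals_limit_subseq:
  assumes A: "fconv A E" and g: "\<And>n. g n \<in> normals (A n)" "g \<longlonglongrightarrow> l" and "l \<noteq> 0"
  shows "l \<in> normals E \<and> (\<exists>f. strict_mono f \<and>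
      set_converges (\<lambda>n. contact_face (A (f n)) (g (f n))) (contact_face E l))"
proof -
  have F: "contact_face (A n) (g n) \<in> faces C" "dim (contact_face (A n) (g n)) = m" for n
    using contact_face_in_faces fconvD[OF A] g(1)[of n] by (auto simp: normals_def)
  obtain f G where f: "strict_mono f" "G \<in> faces C" "dim G = m"
      and conv: "set_converges (\<lambda>n. contact_face (A (f n)) (g (f n))) G"
    using faces_compact[of "\<lambda>n. contact_face (A n) (g n)", OF F] by blast
  have gf: "(\<lambda>n. g (f n)) \<longlonglongrightarrow> l" using LIMSEQ_subseq_LIMSEQ[OF g(2) f(1)] by (simp add: o_def)
  have lE: "l \<in> span E" by (rule span_limit[OF A _ g(2)]) (use g in \<open>auto simp: normals_def\<close>)
  have pos: "0 \<le> l \<bullet> z" if z: "z \<in> E" for z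
  proof -
    obtain x where x: "\<And>n. x n \<in> A n" "x \<longlonglongrightarrow> z" using fconv_approx[OF A z] by blast
    have "(\<lambda>n. g n \<bullet> x n) \<longlonglongrightarrow> l \<bullet> z" by (intro tendsto_inner g x)
    then show ?thesis by (rule LIMSEQ_le_const) (use g(1) x(1) in \<open>auto simp: normals_def\<close>)
  qed
  have "G \<subseteq> contact_face E l"
  proof
    fix z assume "z \<in> G"
    then obtain x where x: "\<And>n. x n \<in> contact_face (A (f n)) (g (f n))" "x \<longlonglongrightarrow> z"
      using set_converges_approx[OF conv] face_props F by metis
    have "z \<in> E"
      using fconv_limit[OF fconv_subseq[OF A f(1)] _ x(2)] x(1) by (auto simp: contact_face_def)
    moreover have "(\<lambda>n. g (f n) \<bullet> x n) \<longlonglongrightarrow> l \<bullet> z" by (intro tendsto_inner gf x)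
    then have "l \<bullet> z = 0" using x(1) by (simp add: contact_face_def LIMSEQ_const_iff)
    ultimately show "z \<in> contact_face E l" by (simp add: contact_face_def)
  qed
  moreover have "dim (contact_face E l) \<le> m"
    using contact_face_dim_le fconvD[OF A] pos lE \<open>l \<noteq> 0\<close> by blast
  ultimately have "G = contact_face E l"
    using face_dim_less[OF contact_face_in_faces[OF fconvD(3)[OF A] pos] f(2)] f(3) by fastforce
  then show ?thesis using f conv lE pos by (auto simp: normals_def)
qed

lemma normals_limit:
  assumes "fconv A E" "\<And>n. g n \<in> normals (A n)" "g \<longlonglongrightarrow> l" "l \<noteq> 0"
  shows "l \<in> normals E"
  using normals_limit_subseq[OF assms] by blast

text \<open>Every subsequence has a further one whose contact faces converge, always to the same
  limit, so the full sequence of distances tends to 0.\<close>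

lemma contact_face_approx:
  assumes A: "fconv A E" and g: "\<And>n. g n \<in> normals (A n)" "g \<longlonglongrightarrow> l" and "l \<noteq> 0"
    and z: "z \<in> contact_face E l"
  obtains x where "\<And>n. x n \<in> contact_face (A n) (g n)" "x \<longlonglongrightarrow> z"
proof (rule infdist_null_approx)
  show "(\<lambda>n. infdist z (contact_face (A n) (g n))) \<longlonglongrightarrow> 0"
  proof (rule tendsto_via_subseq)
    fix f :: "nat \<Rightarrow> nat" assume f: "strict_mono f"
    have "(\<lambda>n. g (f n)) \<longlonglongrightarrow> l" using LIMSEQ_subseq_LIMSEQ[OF g(2) f] by (simp add: o_def)
    from normals_limit_subseq[OF fconv_subseq[OF A f] g(1) this \<open>l \<noteq> 0\<close>]
    obtain h where "set_converges (\<lambda>n. contact_face (A (f (h n))) (g (f (h n)))) (contact_face E l)"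
      by blast
    then have "(\<lambda>n. infdist z (contact_face (A (f (h n))) (g (f (h n))))) \<longlonglongrightarrow> 0"
      using z unfolding set_converges_def by (metis infdist_zero)
    then show "\<exists>h. (\<lambda>n. infdist z (contact_face (A (f (h n))) (g (f (h n))))) \<longlonglongrightarrow> 0" by blast
  qed
  have "contact_face (A n) (g n) \<in> faces C" for n
    using contact_face_in_faces fconvD[OF A] g(1)[of n] by (auto simp: normals_def)
  then show "closed (contact_face (A n) (g n))" "contact_face (A n) (g n) \<noteq> {}" for n
    using face_props by blast+
qed (use that in blast)

text \<open>Each normal is nonnegative on the contact face of the other, so the difference of two nearby
  normals is almost orthogonal to the contact face.\<close>
lemma secant_limit:
  assumes A: "fconv A E" and g: "\<And>n. g n \<in> normals (A n)" "g \<longlonglongrightarrow> l"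
    and g': "\<And>n. g' n \<in> normals (A n)" "g' \<longlonglongrightarrow> l" and "l \<noteq> 0"
    and t: "\<And>n. 0 < t n" and w: "(\<lambda>n. (g' n - g n) /\<^sub>R t n) \<longlonglongrightarrow> w"
  shows "w \<in> span E \<inter> orth (contact_face E l)"
proof
  show "w \<in> span E"
    by (rule span_limit[OF A _ w], rule span_scale, rule span_diff) (use g g' in \<open>auto simp: normals_def\<close>)
  have "w \<bullet> z = 0" if z: "z \<in> contact_face E l" for z
  proof (rule antisym)
    obtain x where x: "\<And>n. x n \<in> contact_face (A n) (g n)" "x \<longlonglongrightarrow> z"
      using contact_face_approx[OF A g \<open>l \<noteq> 0\<close> z] by blast
    have "(\<lambda>n. ((g' n - g n) /\<^sub>R t n) \<bullet> x n) \<longlonglongrightarrow> w \<bullet> z" by (intro tendsto_inner w x)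
    then show "0 \<le> w \<bullet> z"
    proof (rule LIMSEQ_le_const, intro exI allI impI)
      fix n
      have "0 \<le> g' n \<bullet> x n" "g n \<bullet> x n = 0"
        using x(1)[of n] g'(1)[of n] by (auto simp: contact_face_def normals_def)
      then show "0 \<le> ((g' n - g n) /\<^sub>R t n) \<bullet> x n" using t[of n] by (simp add: inner_diff_left)
    qed
    obtain x' where x': "\<And>n. x' n \<in> contact_face (A n) (g' n)" "x' \<longlonglongrightarrow> z"
      using contact_face_approx[OF A g' \<open>l \<noteq> 0\<close> z] by blast
    have "(\<lambda>n. ((g' n - g n) /\<^sub>R t n) \<bullet> x' n) \<longlonglongrightarrow> w \<bullet> z" by (intro tendsto_inner w x')
    then show "w \<bullet> z \<le> 0"
    proof (rule LIMSEQ_le_const2, intro exI allI impI)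
      fix n
      have "0 \<le> g n \<bullet> x' n" "g' n \<bullet> x' n = 0"
        using x'(1)[of n] g(1)[of n] by (auto simp: contact_face_def normals_def)
      then show "((g' n - g n) /\<^sub>R t n) \<bullet> x' n \<le> 0" using t[of n]
        by (simp add: inner_diff_left mult_nonneg_nonpos)
    qed
  qed
  then show "w \<in> orth (contact_face E l)" by (simp add: orth_def)
qed

text \<open>A zero at a single point forces a large contact face: otherwise, by pigeonhole, a
  subsequence of contact faces has one constant dimension below m, as \<open>faces_compact\<close>
  requires. Its limit is a face containing the relative interior point \<open>x0\<close> of
  \<open>F\<close>, hence all of \<open>F\<close>, which has dimension m.\<close>

lemma contact_dim_ge_eventually:
  assumes A: "fconv A E" and F: "F \<in> faces C" "dim F = m" "x0 \<in> rel_interior F"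
    and z: "\<And>n. z n \<in> A n" "z \<longlonglongrightarrow> x0"
  shows "\<forall>\<^sub>F n in sequentially. (\<forall>y\<in>A n. 0 \<le> g n \<bullet> y) \<and> g n \<bullet> z n = 0 \<longrightarrow> m \<le> dim (contact_face (A n) (g n))"
proof (rule eventually_sequentially_via_subseq, rule ccontr)
  fix f :: "nat \<Rightarrow> nat" assume f: "strict_mono f"
  let ?H = "\<lambda>n. contact_face (A (f n)) (g (f n))"
  assume "\<nexists>n. (\<forall>y\<in>A (f n). 0 \<le> g (f n) \<bullet> y) \<and> g (f n) \<bullet> z (f n) = 0 \<longrightarrow> m \<le> dim (?H n)"
  then have H: "\<And>n y. y \<in> A (f n) \<Longrightarrow> 0 \<le> g (f n) \<bullet> y" "\<And>n. g (f n) \<bullet> z (f n) = 0" "\<And>n. dim (?H n) < m"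
    by (auto simp: not_le)
  have "finite (range (\<lambda>n. dim (?H n)))"
    by (rule finite_subset[of _ "{..<m}"]) (use H(3) in auto)
  then obtain n0 where "infinite {n. dim (?H n) = dim (?H n0)}"
    using pigeonhole_infinite[of UNIV "\<lambda>n. dim (?H n)"] by auto
  then obtain h :: "nat \<Rightarrow> nat" where h: "strict_mono h" "\<And>n. dim (?H (h n)) = dim (?H n0)"
    using infinite_enumerate by blast
  have "?H (h n) \<in> faces C" for n
    using contact_face_in_faces fconvD(1)[OF A] H(1) by blast
  then obtain k G where k: "strict_mono k" "G \<in> faces C" "dim G = dim (?H n0)"
      "set_converges (\<lambda>n. ?H (h (k n))) G"
    using faces_compact[of "\<lambda>n. ?H (h n)", OF _ h(2)] by blast
  have "x0 \<in> G"
  proof (rule set_converges_limit[OF k(4)])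
    show "z (f (h (k n))) \<in> ?H (h (k n))" for n using z(1) H(2) by (simp add: contact_face_def)
    show "(\<lambda>n. z (f (h (k n)))) \<longlonglongrightarrow> x0"
      using LIMSEQ_subseq_LIMSEQ[OF z(2) strict_mono_o[OF f strict_mono_o[OF h(1) k(1)]]]
      by (simp add: o_def)
  qed (use face_props k(2) in auto)
  then have "F \<subseteq> G"
    using subset_of_face_of[of G C F] k(2) F face_props(5) by (auto simp: faces_def)
  then have "m \<le> dim G" using dim_subset F(2) by blast
  with k(3) H(3)[of n0] show False by simp
qed

text \<open>The normals are the gradients at the minimisers of a linear form plus a quadratic penalty
  that pins the component along the contact face of \<open>e\<close>.\<close>
lemma normals_exist:
  assumes A: "fconv A E" and e: "e \<in> normals E" "norm e = 1"
    and u: "\<And>n. u n \<in> span E \<inter> orth (contact_face E e) \<inter> orth {e}" "u \<longlonglongrightarrow> 0"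
  obtains g where "g \<longlonglongrightarrow> e" "\<forall>\<^sub>F n in sequentially. g n \<in> normals (A n) \<and> g n \<bullet> e = 1 \<and>
      (\<forall>l\<in>span E \<inter> orth (contact_face E e) \<inter> orth {e}. g n \<bullet> l = u n \<bullet> l)"
proof -
  define F where "F = contact_face E e"
  have eE: "e \<in> span E" "\<And>z. z \<in> E \<Longrightarrow> 0 \<le> e \<bullet> z" and dF: "dim F = m"
    using e by (auto simp: normals_def F_def)
  have F: "F \<in> faces C" unfolding F_def using contact_face_in_faces fconvD[OF A] eE by blast
  have FE: "F \<subseteq> E" "\<And>z. z \<in> F \<Longrightarrow> e \<bullet> z = 0" by (auto simp: F_def contact_face_def)
  obtain x0 where x0: "x0 \<in> rel_interior F"
    using rel_interior_eq_empty face_props[OF F] by blast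
  then have x0F: "x0 \<in> F" using rel_interior_subset by blast
  then have x0E: "x0 \<in> E" using FE by blast
  obtain B where B: "B \<subseteq> F" "independent B" "F \<subseteq> span B" by (rule basis_exists[of F])
  have finB: "finite B" using B(2) independent_imp_finite by blast
  \<comment> \<open>The penalty directions are moved into the approximating spans, so that the
    gradient stays there, without changing their inner products with the span of
    \<open>E\<close>.\<close>
  have "\<forall>f\<in>B. \<exists>c. (\<forall>n. c n \<in> span (A n)) \<and> c \<longlonglongrightarrow> f \<and> (\<forall>\<^sub>F n in sequentially. \<forall>t\<in>span E. c n \<bullet> t = f \<bullet> t)"
  proof
    fix f assume "f \<in> B"
    then have "f \<in> span E" using B FE span_base by blast
    from span_lift[OF A this tendsto_const]
    obtain c where "\<And>n. c n \<in> span (A n)" "c \<longlonglongrightarrow> f"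
        "\<forall>\<^sub>F n in sequentially. \<forall>t\<in>span E. c n \<bullet> t = f \<bullet> t" by blast
    then show "\<exists>c. (\<forall>n. c n \<in> span (A n)) \<and> c \<longlonglongrightarrow> f \<and> (\<forall>\<^sub>F n in sequentially. \<forall>t\<in>span E. c n \<bullet> t = f \<bullet> t)"
      by blast
  qed
  from bchoice[OF this] obtain c where "\<forall>f\<in>B. (\<forall>n. c f n \<in> span (A n)) \<and> c f \<longlonglongrightarrow> f \<and>
      (\<forall>\<^sub>F n in sequentially. \<forall>t\<in>span E. c f n \<bullet> t = f \<bullet> t)" by blast
  then have c: "\<And>f n. f \<in> B \<Longrightarrow> c f n \<in> span (A n)" "\<And>f. f \<in> B \<Longrightarrow> c f \<longlonglongrightarrow> f"
      "\<And>f. f \<in> B \<Longrightarrow> \<forall>\<^sub>F n in sequentially. \<forall>t\<in>span E. c f n \<bullet> t = f \<bullet> t"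
    by blast+
  have y: "e + u n \<in> span E" for n using u(1) eE span_add by blast
  have "(\<lambda>n. e + u n) \<longlonglongrightarrow> e + 0" by (intro tendsto_intros u)
  then have "(\<lambda>n. e + u n) \<longlonglongrightarrow> e" by simp
  from span_lift[OF A y this] obtain a where a: "\<And>n. a n \<in> span (A n)" "a \<longlonglongrightarrow> e"
      "\<forall>\<^sub>F n in sequentially. \<forall>t\<in>span E. a n \<bullet> t = (e + u n) \<bullet> t" by blast
  \<comment> \<open>In the limit the linear part is \<open>e\<close>, which is nonnegative on
    \<open>E\<close> and zero only on \<open>F\<close>, and on \<open>F\<close> the penalty vanishes
    only at \<open>x0\<close>. So \<open>x0\<close> is the unique minimiser of the limit
    problem.\<close>
  define q where "q n z = a n \<bullet> z + (1/2) * (\<Sum>f\<in>B. ((z - x0) \<bullet> c f n)\<^sup>2)" for n z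
  have q_lim: "(\<lambda>n. q (h n) (z n)) \<longlonglongrightarrow> e \<bullet> l + (1/2) * (\<Sum>f\<in>B. ((l - x0) \<bullet> f)\<^sup>2)"
    if h: "strict_mono h" and z: "z \<longlonglongrightarrow> l" for h :: "nat \<Rightarrow> nat" and z l
  proof -
    have "(\<lambda>n. a (h n)) \<longlonglongrightarrow> e" using LIMSEQ_subseq_LIMSEQ[OF a(2) h] by (simp add: o_def)
    moreover have "(\<lambda>n. c f (h n)) \<longlonglongrightarrow> f" if "f \<in> B" for f
      using LIMSEQ_subseq_LIMSEQ[OF c(2)[OF that] h] by (simp add: o_def)
    ultimately show ?thesis unfolding q_def by (intro tendsto_intros z)
  qed
  obtain x where x: "\<And>n. x n \<in> A n" "x \<longlonglongrightarrow> x0" using fconv_approx[OF A x0E] by blast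
  \<comment> \<open>The ball contains the competitor \<open>x n\<close>; the extra 1 leaves room
    around \<open>x0\<close>, so that minimisers tending to \<open>x0\<close> are local minimisers
    over all of \<open>A n\<close>.\<close>
  define K where "K n = A n \<inter> cball x0 (1 + dist x0 (x n))" for n
  have "\<exists>z\<in>K n. \<forall>z'\<in>K n. q n z \<le> q n z'" for n
  proof (rule continuous_attains_inf)
    show "compact (K n)" unfolding K_def
      using face_props fconvD(1)[OF A] by (intro closed_Int_compact) auto
    show "K n \<noteq> {}" using x(1)[of n] by (auto simp: K_def)
    show "continuous_on (K n) (q n)" unfolding q_def by (intro continuous_intros)
  qed
  then obtain z where z: "\<And>n. z n \<in> K n" "\<And>n z'. z' \<in> K n \<Longrightarrow> q n (z n) \<le> q n z'" by metis
  have zA: "z n \<in> A n" for n using z(1) by (auto simp: K_def)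
  have "z \<longlonglongrightarrow> x0"
  proof -
    have "convergent (\<lambda>n. dist x0 (x n))"
      using x(2) tendsto_dist[OF tendsto_const x(2)] convergentI by blast
    then obtain M where M: "\<And>n. norm (dist x0 (x n)) \<le> M"
      using convergent_imp_Bseq[of "\<lambda>n. dist x0 (x n)"] by (auto simp: Bseq_def)
    have "norm (z n) \<le> norm x0 + (1 + M)" for n
    proof -
      have "dist x0 (z n) \<le> 1 + M" using z(1)[of n] M[of n] by (auto simp: K_def)
      then show ?thesis using norm_triangle_sub[of "z n" x0] by (simp add: dist_norm norm_minus_commute)
    qed
    then show ?thesis
    proof (rule tendsto_via_limit_points)
      fix h l assume h: "strict_mono h" "(\<lambda>n. z (h n)) \<longlonglongrightarrow> l"
      have lE: "l \<in> E" by (rule fconv_limit[OF fconv_subseq[OF A h(1)] _ h(2)]) (rule zA)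
      have "(\<lambda>n. x (h n)) \<longlonglongrightarrow> x0" using LIMSEQ_subseq_LIMSEQ[OF x(2) h(1)] by (simp add: o_def)
      from q_lim[OF h(1) this] have "(\<lambda>n. q (h n) (x (h n))) \<longlonglongrightarrow> 0"
        using FE(2)[OF x0F] by simp
      moreover have "q (h n) (z (h n)) \<le> q (h n) (x (h n))" for n
        by (rule z(2)) (use x(1)[of "h n"] in \<open>auto simp: K_def\<close>)
      ultimately have "e \<bullet> l + (1/2) * (\<Sum>f\<in>B. ((l - x0) \<bullet> f)\<^sup>2) \<le> 0"
        using LIMSEQ_le[OF q_lim[OF h]] by blast
      moreover have "0 \<le> (\<Sum>f\<in>B. ((l - x0) \<bullet> f)\<^sup>2)" by (intro sum_nonneg) simp
      ultimately have el: "e \<bullet> l = 0" and "(\<Sum>f\<in>B. ((l - x0) \<bullet> f)\<^sup>2) = 0"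
        using eE(2)[OF lE] by linarith+
      then have "\<forall>f\<in>B. orthogonal (l - x0) f"
        using sum_nonneg_eq_0_iff[OF finB, of "\<lambda>f. ((l - x0) \<bullet> f)\<^sup>2"] by (simp add: orthogonal_def)
      then have "orthogonal (l - x0) y" if "y \<in> span B" for y
        using orthogonal_to_span that by blast
      moreover have "l - x0 \<in> span B"
        using B(3) lE el x0F by (intro span_diff) (auto simp: F_def contact_face_def)
      ultimately have "l - x0 = 0" using orthogonal_self by blast
      then show "l = x0" by simp
    qed
  qed
  define G where "G n = a n + (\<Sum>f\<in>B. ((z n - x0) \<bullet> c f n) *\<^sub>R c f n)" for n
  have "G \<longlonglongrightarrow> e + (\<Sum>f\<in>B. ((x0 - x0) \<bullet> f) *\<^sub>R f)"
    unfolding G_def by (intro tendsto_intros a c \<open>z \<longlonglongrightarrow> x0\<close>)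
  then have Glim: "G \<longlonglongrightarrow> e" by simp
  have Gsp: "G n \<in> span (A n)" for n
    unfolding G_def by (intro span_add span_sum span_scale a c)
  have "\<forall>\<^sub>F n in sequentially. dist (z n) x0 < 1"
    using tendstoD[OF \<open>z \<longlonglongrightarrow> x0\<close>, of 1] by simp
  then have var: "\<forall>\<^sub>F n in sequentially. (\<forall>y\<in>A n. 0 \<le> G n \<bullet> y) \<and> G n \<bullet> z n = 0"
  proof eventually_elim
    case (elim n)
    have *: "0 \<le> G n \<bullet> (y - z n)" if "y \<in> A n" for y
      unfolding G_def
    proof (rule quadratic_min_variational[OF face_props(2)[OF fconvD(1)[OF A]] zA _ that])
      show "0 < 1 - dist (z n) x0" using elim by simp
      fix z' assume z': "z' \<in> A n" "dist (z n) z' < 1 - dist (z n) x0"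
      have "dist x0 z' \<le> dist (z n) x0 + dist (z n) z'"
        by (metis dist_commute dist_triangle)
      then have "z' \<in> K n" using z' by (auto simp: K_def intro: order_trans add_increasing2)
      from z(2)[OF this]
      show "a n \<bullet> z n + (1/2) * (\<Sum>f\<in>B. ((z n - x0) \<bullet> c f n)\<^sup>2)
          \<le> a n \<bullet> z' + (1/2) * (\<Sum>f\<in>B. ((z' - x0) \<bullet> c f n)\<^sup>2)" by (simp add: q_def)
    qed
    \<comment> \<open>\<open>A n\<close> is a cone: the test points 0 and twice \<open>z n\<close>
      give the two inequalities.\<close>
    have "G n \<bullet> z n \<le> 0"
      using *[of 0] face_props(3)[OF fconvD(1)[OF A]] by simp
    moreover have "0 \<le> G n \<bullet> z n"
      using *[of "2 *\<^sub>R z n"] face_props(4)[OF fconvD(1)[OF A] zA, of 2] by (simp add: inner_diff_right)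
    ultimately show ?case using * by (auto simp: inner_diff_right)
  qed
  have cB: "\<forall>\<^sub>F n in sequentially. \<forall>f\<in>B. \<forall>t\<in>span E. c f n \<bullet> t = f \<bullet> t"
    using c(3) finB by (simp add: eventually_ball_finite_distrib)
  have coord: "\<forall>\<^sub>F n in sequentially. G n \<bullet> e = 1 \<and>
      (\<forall>l\<in>span E \<inter> orth (contact_face E e) \<inter> orth {e}. G n \<bullet> l = u n \<bullet> l)"
    using cB a(3)
  proof eventually_elim
    case (elim n)
    \<comment> \<open>The lifted penalty directions pair with the span of \<open>E\<close> as
      elements of \<open>F\<close> do, hence vanish on vectors orthogonal to \<open>F\<close>. There
      the gradient acts exactly as \<open>e + u n\<close>, wherever the minimiser lies.\<close>
    have *: "G n \<bullet> t = (e + u n) \<bullet> t" if t: "t \<in> span E" "t \<in> orth F" for t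
    proof -
      have "c f n \<bullet> t = 0" if "f \<in> B" for f
        using elim that t B(1) by (auto simp: orth_def inner_commute)
      then have "(\<Sum>f\<in>B. ((z n - x0) \<bullet> c f n) *\<^sub>R c f n) \<bullet> t = 0"
        by (simp add: inner_sum_left)
      then show ?thesis using elim t by (simp add: G_def inner_add_left)
    qed
    have "e \<in> orth F" using FE(2) by (simp add: orth_def)
    then have "G n \<bullet> e = (e + u n) \<bullet> e" using * eE by blast
    moreover have "u n \<bullet> e = 0" using u(1)[of n] by (simp add: orth_def)
    ultimately have "G n \<bullet> e = 1" using e(2) by (simp add: inner_add_left norm_eq_1)
    moreover have "G n \<bullet> l = u n \<bullet> l" if "l \<in> span E \<inter> orth (contact_face E e) \<inter> orth {e}" for l
      using *[of l] that by (simp add: F_def orth_def inner_add_left inner_add_right inner_commute[of e] inner_commute[of _ l])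
    ultimately show ?case by blast
  qed
  have "\<forall>\<^sub>F n in sequentially. G n \<in> normals (A n)"
    using contact_dim_ge_eventually[OF A F dF x0 zA \<open>z \<longlonglongrightarrow> x0\<close>, of G] var coord
  proof eventually_elim
    case (elim n)
    then have "dim (contact_face (A n) (G n)) \<le> m"
      using contact_face_dim_le[OF fconvD(1,2)[OF A], where g = "G n"] Gsp by fastforce
    with elim show ?case using Gsp unfolding normals_def by simp
  qed
  with coord have "\<forall>\<^sub>F n in sequentially. G n \<in> normals (A n) \<and> G n \<bullet> e = 1 \<and>
      (\<forall>l\<in>span E \<inter> orth (contact_face E e) \<inter> orth {e}. G n \<bullet> l = u n \<bullet> l)"
    by eventually_elim blast
  with Glim that show ?thesis by blast
qed

end

section \<open>Charts of the bundle of normals\<close>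

lemma tendsto_of_dist_less_inverse:
  fixes x :: "nat \<Rightarrow> 'a::metric_space"
  assumes "\<And>n. dist l (x n) < inverse (real (Suc n))"
  shows "x \<longlonglongrightarrow> l"
proof -
  have "(\<lambda>n. dist (x n) l) \<longlonglongrightarrow> 0"
    by (rule Lim_null_comparison[OF _ LIMSEQ_inverse_real_of_nat])
      (use assms in \<open>auto simp: dist_commute less_imp_le intro!: always_eventually\<close>)
  then show ?thesis using tendsto_dist_iff by blast
qed

text \<open>\<open>e\<close> may lie outside \<open>Y\<close>; on \<open>Y\<close> it acts through
  its projection, which is nonzero because it pairs with \<open>g\<close> as \<open>e\<close>
  does.\<close>

lemma dim_subspace_orth_vector:
  fixes Y :: "'a::euclidean_space set"
  assumes Y: "subspace Y" and g: "g \<in> Y" "g \<bullet> e \<noteq> 0"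
  shows "dim (Y \<inter> orth {e}) + 1 = dim Y"
proof -
  let ?p = "orth_proj Y e"
  have p: "?p \<in> Y" "\<And>y. y \<in> Y \<Longrightarrow> ?p \<bullet> y = e \<bullet> y" using orth_proj[OF Y] by auto
  have "?p \<noteq> 0" using p(2)[OF g(1)] g(2) by (auto simp: inner_commute)
  have "Y \<inter> orth {e} = {y \<in> Y. \<forall>x\<in>span {?p}. orthogonal x y}"
  proof -
    have "(\<forall>x\<in>span {?p}. orthogonal x y) \<longleftrightarrow> y \<bullet> e = 0" if "y \<in> Y" for y
    proof -
      have "(\<forall>x\<in>span {?p}. orthogonal x y) \<longleftrightarrow> ?p \<bullet> y = 0"
        by (force simp: span_singleton orthogonal_def)
      also have "\<dots> \<longleftrightarrow> y \<bullet> e = 0" using p(2)[OF that] by (simp add: inner_commute)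
      finally show ?thesis .
    qed
    then show ?thesis by (auto simp: orth_def)
  qed
  moreover have "dim (span {?p}) = 1" using \<open>?p \<noteq> 0\<close> by (simp add: dim_singleton)
  moreover have "span {?p} \<subseteq> Y" using p(1) Y by (simp add: span_minimal)
  ultimately show ?thesis
    using dim_subspace_orthogonal_to_vectors[OF subspace_span Y, of "{?p}"] by simp
qed

lemma has_derivative_sgn:
  fixes x :: "'a::real_inner"
  assumes "x \<noteq> 0"
  shows "(sgn has_derivative (\<lambda>h. h /\<^sub>R norm x - ((x \<bullet> h) / norm x ^ 3) *\<^sub>R x)) (at x)"
proof -
  have "((\<lambda>y. inverse (norm y) *\<^sub>R y) has_derivative
      (\<lambda>h. inverse (norm x) *\<^sub>R h + (- (inverse (norm x) * (h \<bullet> sgn x) * inverse (norm x))) *\<^sub>R x)) (at x)"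
    using has_derivative_scaleR[OF has_derivative_compose[OF has_derivative_norm[OF assms] has_derivative_inverse']
      has_derivative_ident] assms
    by simp
  moreover have "(\<lambda>y. inverse (norm y) *\<^sub>R y) = (sgn :: 'a \<Rightarrow> 'a)" by (rule ext) (rule sgn_div_norm[symmetric])
  moreover have "inverse (norm x) *\<^sub>R h + (- (inverse (norm x) * (h \<bullet> sgn x) * inverse (norm x))) *\<^sub>R x
      = h /\<^sub>R norm x - ((x \<bullet> h) / norm x ^ 3) *\<^sub>R x" for h
  proof -
    have "inverse (norm x) * (h \<bullet> sgn x) * inverse (norm x) = (x \<bullet> h) / norm x ^ 3"
      using assms by (simp add: sgn_div_norm inner_commute[of h] power3_eq_cube divide_simps)
    then show ?thesis by simp
  qed
  ultimately show ?thesis by (simp only:)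
qed

section \<open>Coordinates on the bundle near a base point\<close>

locale face_chart = face_gap C r m for C :: "'a::euclidean_space set" and r m :: nat +
  fixes BB :: "'a set set" and E0 :: "'a set" and e0 :: 'a
  assumes BB: "BB \<subseteq> {E \<in> faces C. dim E = r}" and E0: "E0 \<in> BB"
    and e0: "e0 \<in> normals E0" "norm e0 = 1"
begin

definition L :: "'a set" where
  "L = span E0 \<inter> orth (contact_face E0 e0) \<inter> orth {e0}"

abbreviation P :: "'a \<Rightarrow> 'a" where "P \<equiv> orth_proj L"

text \<open>An affine slice of the cone of normals. Differences of its elements are orthogonal to
  \<open>e0\<close>, so limits of secants need no correction by a radial component.\<close>

definition hnormals :: "'a set \<Rightarrow> 'a set" where
  "hnormals E = {g \<in> normals E. g \<bullet> e0 = 1}"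

text \<open>The tangent space of the slice, not of the sphere: hence orthogonality to
  \<open>e0\<close> instead of to \<open>g\<close>. At the base point the two agree.\<close>

definition tang :: "'a set \<Rightarrow> 'a \<Rightarrow> 'a set" where
  "tang E g = span E \<inter> orth (contact_face E g) \<inter> orth {e0}"

lemma subspace_L: "subspace L"
  unfolding L_def by (intro subspace_inter subspace_span subspace_orth)

lemma subspace_tang: "subspace (tang E g)"
  unfolding tang_def by (intro subspace_inter subspace_span subspace_orth)

sublocale P: bounded_linear P
  by (rule bounded_linear_orth_proj[OF subspace_L])

lemma BB_faces: "E \<in> BB \<Longrightarrow> E \<in> faces C \<and> dim E = r"
  using BB by blast

lemma BB_closed: "BB \<subseteq> {A. closed A \<and> A \<noteq> {}}"
  using BB_faces face_props(1,6) by blast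

lemma fconvI: "(\<And>n. A n \<in> BB) \<Longrightarrow> E \<in> BB \<Longrightarrow> set_converges A E \<Longrightarrow> fconv A E"
  unfolding fconv_def using BB_faces by blast

lemma e0_inner: "e0 \<bullet> e0 = 1"
  using e0(2) by (simp add: norm_eq_1)

lemma e0_hnormals: "e0 \<in> hnormals E0"
  using e0 e0_inner by (simp add: hnormals_def)

lemma tang_e0: "tang E0 e0 = L"
  by (simp add: tang_def L_def)

lemma P_e0: "P e0 = 0"
  by (rule orth_proj_unique[OF subspace_L subspace_0[OF subspace_L]])
    (auto simp: L_def orth_def inner_commute)

text \<open>Orthogonality to the contact face costs m dimensions. Orthogonality to \<open>e0\<close>
  costs one more, because \<open>g\<close> lies in the space being cut and pairs to 1 with
  \<open>e0\<close>.\<close>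

lemma dim_tang:
  assumes "E \<in> BB" "g \<in> hnormals E"
  shows "dim (tang E g) = r - m - 1"
proof -
  let ?F = "contact_face E g"
  have g: "g \<in> span E" "dim ?F = m" "g \<bullet> e0 = 1"
    using assms by (auto simp: hnormals_def normals_def)
  have "dim {y \<in> span E. \<forall>x\<in>span ?F. orthogonal x y} + dim (span ?F) = dim (span E)"
    by (intro dim_subspace_orthogonal_to_vectors subspace_span span_mono) (auto simp: contact_face_def)
  moreover have "{y \<in> span E. \<forall>x\<in>span ?F. orthogonal x y} = span E \<inter> orth ?F"
  proof -
    have "(\<forall>x\<in>span ?F. orthogonal x y) \<longleftrightarrow> (\<forall>x\<in>?F. orthogonal x y)" for y
      by (meson orthogonal_commute orthogonal_to_span span_base)
    then show ?thesis by (auto simp: orth_def orthogonal_def inner_commute)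
  qed
  ultimately have "dim (span E \<inter> orth ?F) + m = r"
    using g(2) BB_faces[OF assms(1)] by simp
  moreover have "dim (span E \<inter> orth ?F \<inter> orth {e0}) + 1 = dim (span E \<inter> orth ?F)"
    by (rule dim_subspace_orth_vector[OF subspace_inter[OF subspace_span subspace_orth], of g])
      (use g in \<open>auto simp: orth_def contact_face_def\<close>)
  ultimately show ?thesis by (simp add: tang_def)
qed

lemma dim_L: "dim L = r - m - 1"
  using dim_tang[OF E0 e0_hnormals] by (simp add: tang_e0)

lemma tang_limit:
  assumes A: "fconv A E" and g: "\<And>n. g n \<in> normals (A n)" "g \<longlonglongrightarrow> l" and "l \<noteq> 0"
    and w: "\<And>n. w n \<in> tang (A n) (g n)" "w \<longlonglongrightarrow> w'"
  shows "w' \<in> tang E l"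
proof -
  have "w' \<in> span E" by (rule span_limit[OF A _ w(2)]) (use w in \<open>auto simp: tang_def\<close>)
  moreover have "w' \<bullet> z = 0" if z: "z \<in> contact_face E l" for z
  proof -
    obtain x where x: "\<And>n. x n \<in> contact_face (A n) (g n)" "x \<longlonglongrightarrow> z"
      using contact_face_approx[OF A g \<open>l \<noteq> 0\<close> z] by blast
    have "(\<lambda>n. w n \<bullet> x n) \<longlonglongrightarrow> w' \<bullet> z" by (intro tendsto_inner w x)
    moreover have "w n \<bullet> x n = 0" for n using w(1)[of n] x(1)[of n] by (auto simp: tang_def orth_def)
    ultimately show ?thesis by (simp add: LIMSEQ_const_iff)
  qed
  moreover have "w' \<bullet> e0 = 0"
  proof -
    have "(\<lambda>n. w n \<bullet> e0) \<longlonglongrightarrow> w' \<bullet> e0" by (intro tendsto_inner w tendsto_const)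
    moreover have "w n \<bullet> e0 = 0" for n using w(1)[of n] by (auto simp: tang_def orth_def)
    ultimately show ?thesis by (simp add: LIMSEQ_const_iff)
  qed
  ultimately show ?thesis by (simp add: tang_def orth_def)
qed

lemma hsecant_limit:
  assumes "fconv A E" "\<And>n. g n \<in> hnormals (A n)" "g \<longlonglongrightarrow> l"
    "\<And>n. g' n \<in> hnormals (A n)" "g' \<longlonglongrightarrow> l" "l \<noteq> 0" "\<And>n. 0 < t n"
    and w: "(\<lambda>n. (g' n - g n) /\<^sub>R t n) \<longlonglongrightarrow> w"
  shows "w \<in> tang E l"
proof -
  have "w \<in> span E \<inter> orth (contact_face E l)"
    by (rule secant_limit[OF assms(1) _ assms(3) _ assms(5-8)]) (use assms in \<open>auto simp: hnormals_def\<close>)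
  moreover have "w \<bullet> e0 = 0"
  proof -
    have "(\<lambda>n. 0) \<longlonglongrightarrow> w \<bullet> e0"
      using tendsto_inner[OF w tendsto_const[of e0]] assms(2,4) by (simp add: hnormals_def inner_diff_left)
    then show ?thesis by (simp add: LIMSEQ_const_iff)
  qed
  ultimately show ?thesis by (simp add: tang_def orth_def)
qed

text \<open>Secants between normals near \<open>e0\<close> accumulate only in \<open>L\<close>. So
  \<open>P\<close> is injective on the slices near \<open>e0\<close>, with a 2-Lipschitz inverse,
  uniformly in the face.\<close>

lemma hnormals_lower_bound:
  obtains \<rho> N where "0 < \<rho>" "openin (subtopology fell_topology BB) N" "E0 \<in> N"
    "\<And>E g g'. E \<in> N \<Longrightarrow> g \<in> hnormals E \<Longrightarrow> g' \<in> hnormals E \<Longrightarrow> dist e0 g < \<rho> \<Longrightarrow> dist e0 g' < \<rho> \<Longrightarrow>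
      norm (g' - g) \<le> 2 * norm (P (g' - g))"
proof -
  define Q where "Q k E \<longleftrightarrow> (\<forall>g\<in>hnormals E. \<forall>g'\<in>hnormals E. dist e0 g < inverse (real (Suc k)) \<longrightarrow>
      dist e0 g' < inverse (real (Suc k)) \<longrightarrow> norm (g' - g) \<le> 2 * norm (P (g' - g)))" for k E
  obtain k N where kN: "openin (subtopology fell_topology BB) N" "E0 \<in> N" "\<And>E. E \<in> N \<Longrightarrow> Q k E"
  proof (rule fell_neighbourhood_via_sequences[OF BB_closed E0, of Q])
    fix s assume s: "\<And>k. s k \<in> BB" "set_converges s E0"
    show "\<exists>k. Q k (s k)"
    proof (rule ccontr)
      assume "\<nexists>k. Q k (s k)"
      then have "\<forall>k. \<exists>g g'. g \<in> hnormals (s k) \<and> g' \<in> hnormals (s k) \<and> dist e0 g < inverse (real (Suc k)) \<and>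
          dist e0 g' < inverse (real (Suc k)) \<and> 2 * norm (P (g' - g)) < norm (g' - g)"
        unfolding Q_def by (meson not_le)
      then obtain g g' where g: "\<And>k. g k \<in> hnormals (s k)" "\<And>k. dist e0 (g k) < inverse (real (Suc k))"
        and g': "\<And>k. g' k \<in> hnormals (s k)" "\<And>k. dist e0 (g' k) < inverse (real (Suc k))"
        and lt: "\<And>k. 2 * norm (P (g' k - g k)) < norm (g' k - g k)" by metis
      have lim: "g \<longlonglongrightarrow> e0" "g' \<longlonglongrightarrow> e0" using tendsto_of_dist_less_inverse g(2) g'(2) by blast+
      show False
      proof (rule sgn_limit_contradiction[OF subspace_L lt])
        fix f l assume f: "strict_mono f" "(\<lambda>n. sgn (g' (f n) - g (f n))) \<longlonglongrightarrow> l"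
        have "l \<in> tang E0 e0"
        proof (rule hsecant_limit[OF fconv_subseq[OF fconvI[OF s(1) E0 s(2)] f(1)]])
          show "(\<lambda>n. g (f n)) \<longlonglongrightarrow> e0" "(\<lambda>n. g' (f n)) \<longlonglongrightarrow> e0"
            using LIMSEQ_subseq_LIMSEQ[OF lim(1) f(1)] LIMSEQ_subseq_LIMSEQ[OF lim(2) f(1)]
            by (simp_all add: o_def)
          show "0 < norm (g' (f n) - g (f n))" for n
            using lt[of "f n"] norm_ge_zero[of "P (g' (f n) - g (f n))"] by linarith
          show "(\<lambda>n. (g' (f n) - g (f n)) /\<^sub>R norm (g' (f n) - g (f n))) \<longlonglongrightarrow> l"
            using f(2) by (simp add: sgn_div_norm)
        qed (use g g' e0 in auto)
        then show "l \<in> L" by (simp add: tang_e0)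
      qed
    qed
  qed blast
  show ?thesis
    by (rule that[of "inverse (real (Suc k))" N]) (use kN in \<open>auto simp: Q_def\<close>)
qed

lemma tang_lower_bound:
  obtains \<rho> N where "0 < \<rho>" "openin (subtopology fell_topology BB) N" "E0 \<in> N"
    "\<And>E g w. E \<in> N \<Longrightarrow> g \<in> hnormals E \<Longrightarrow> dist e0 g < \<rho> \<Longrightarrow> w \<in> tang E g \<Longrightarrow> norm w \<le> 2 * norm (P w)"
proof -
  define Q where "Q k E \<longleftrightarrow> (\<forall>g\<in>hnormals E. dist e0 g < inverse (real (Suc k)) \<longrightarrow>
      (\<forall>w\<in>tang E g. norm w \<le> 2 * norm (P w)))" for k E
  obtain k N where kN: "openin (subtopology fell_topology BB) N" "E0 \<in> N" "\<And>E. E \<in> N \<Longrightarrow> Q k E"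
  proof (rule fell_neighbourhood_via_sequences[OF BB_closed E0, of Q])
    fix s assume s: "\<And>k. s k \<in> BB" "set_converges s E0"
    show "\<exists>k. Q k (s k)"
    proof (rule ccontr)
      assume "\<nexists>k. Q k (s k)"
      then have "\<forall>k. \<exists>g w. g \<in> hnormals (s k) \<and> dist e0 g < inverse (real (Suc k)) \<and> w \<in> tang (s k) g \<and>
          2 * norm (P w) < norm w"
        unfolding Q_def by (meson not_le)
      then obtain g w where g: "\<And>k. g k \<in> hnormals (s k)" "\<And>k. dist e0 (g k) < inverse (real (Suc k))"
        and w: "\<And>k. w k \<in> tang (s k) (g k)"
        and lt: "\<And>k. 2 * norm (P (w k)) < norm (w k)" by metis
      have lim: "g \<longlonglongrightarrow> e0" using tendsto_of_dist_less_inverse g(2) by blast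
      show False
      proof (rule sgn_limit_contradiction[OF subspace_L lt])
        fix f l assume f: "strict_mono f" "(\<lambda>n. sgn (w (f n))) \<longlonglongrightarrow> l"
        have "l \<in> tang E0 e0"
        proof (rule tang_limit[OF fconv_subseq[OF fconvI[OF s(1) E0 s(2)] f(1)] _ _ _ _ f(2)])
          show "(\<lambda>n. g (f n)) \<longlonglongrightarrow> e0"
            using LIMSEQ_subseq_LIMSEQ[OF lim(1) f(1)] by (simp add: o_def)
          show "sgn (w (f n)) \<in> tang (s (f n)) (g (f n))" for n
            using w subspace_scale[OF subspace_tang] by (simp add: sgn_div_norm)
        qed (use g e0 in \<open>auto simp: hnormals_def\<close>)
        then show "l \<in> L" by (simp add: tang_e0)
      qed
    qed
  qed blast
  show ?thesis
    by (rule that[of "inverse (real (Suc k))" N]) (use kN in \<open>auto simp: Q_def\<close>)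
qed

text \<open>Counterexamples \<open>u k\<close> of norm below 1/(k+1) turn the sequential
  \<open>normals_exist\<close> into one \<delta> and one neighbourhood. The bound by \<rho> / 2 is a
  closed condition that limits inherit, and it stays strictly inside the radius on which
  \<open>P\<close> is injective.\<close>

lemma hnormals_exist:
  assumes "0 < \<rho>"
  obtains \<delta> N where "0 < \<delta>" "openin (subtopology fell_topology BB) N" "E0 \<in> N"
    "\<And>E u. E \<in> N \<Longrightarrow> u \<in> L \<Longrightarrow> norm u < \<delta> \<Longrightarrow> \<exists>g\<in>hnormals E. dist e0 g \<le> \<rho> / 2 \<and> P g = u"
proof -
  define Q where "Q k E \<longleftrightarrow> (\<forall>u\<in>L. norm u < inverse (real (Suc k)) \<longrightarrow>
      (\<exists>g\<in>hnormals E. dist e0 g \<le> \<rho> / 2 \<and> P g = u))" for k E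
  obtain k N where kN: "openin (subtopology fell_topology BB) N" "E0 \<in> N" "\<And>E. E \<in> N \<Longrightarrow> Q k E"
  proof (rule fell_neighbourhood_via_sequences[OF BB_closed E0, of Q])
    fix s assume s: "\<And>k. s k \<in> BB" "set_converges s E0"
    show "\<exists>k. Q k (s k)"
    proof (rule ccontr)
      assume "\<nexists>k. Q k (s k)"
      then have "\<forall>k. \<exists>u. u \<in> L \<and> norm u < inverse (real (Suc k)) \<and>
          \<not> (\<exists>g\<in>hnormals (s k). dist e0 g \<le> \<rho> / 2 \<and> P g = u)"
        unfolding Q_def by blast
      then obtain u where u: "\<And>k. u k \<in> L" "\<And>k. norm (u k) < inverse (real (Suc k))"
        and no: "\<And>k. \<not> (\<exists>g\<in>hnormals (s k). dist e0 g \<le> \<rho> / 2 \<and> P g = u k)" by metis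
      have "u \<longlonglongrightarrow> 0" by (rule tendsto_of_dist_less_inverse) (use u in \<open>simp add: dist_norm\<close>)
      then obtain g where g: "g \<longlonglongrightarrow> e0" "\<forall>\<^sub>F n in sequentially. g n \<in> normals (s n) \<and> g n \<bullet> e0 = 1 \<and>
          (\<forall>l\<in>L. g n \<bullet> l = u n \<bullet> l)"
        using normals_exist[OF fconvI[OF s(1) E0 s(2)] e0, of u] u(1) unfolding L_def by blast
      have "\<forall>\<^sub>F n in sequentially. dist (g n) e0 < \<rho> / 2" using tendstoD[OF g(1), of "\<rho> / 2"] assms by simp
      with g(2) have "\<forall>\<^sub>F n in sequentially. False"
      proof eventually_elim
        case (elim n)
        have "P (g n) = u n" by (rule orth_proj_unique[OF subspace_L u(1)]) (use elim in simp)
        then show False using no[of n] elim by (auto simp: hnormals_def dist_commute)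
      qed
      then show False by simp
    qed
  qed blast
  show ?thesis
    by (rule that[of "inverse (real (Suc k))" N]) (use kN in \<open>auto simp: Q_def\<close>)
qed

end

section \<open>The inverse of the coordinate and its derivative\<close>

locale face_chart_nbhd = face_chart C r m BB E0 e0
  for C :: "'a::euclidean_space set" and r m :: nat and BB E0 e0 +
  fixes \<rho> \<delta> :: real and W :: "'a set set"
  assumes pos: "0 < \<rho>" "0 < \<delta>" and W: "W \<subseteq> BB" "E0 \<in> W"
    and lower: "\<And>E g g'. E \<in> W \<Longrightarrow> g \<in> hnormals E \<Longrightarrow> g' \<in> hnormals E \<Longrightarrow> dist e0 g < \<rho> \<Longrightarrow>
      dist e0 g' < \<rho> \<Longrightarrow> norm (g' - g) \<le> 2 * norm (P (g' - g))"
    and lower_tang: "\<And>E g w. E \<in> W \<Longrightarrow> g \<in> hnormals E \<Longrightarrow> dist e0 g < \<rho> \<Longrightarrow> w \<in> tang E g \<Longrightarrow>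
      norm w \<le> 2 * norm (P w)"
    and ex: "\<And>E u. E \<in> W \<Longrightarrow> u \<in> L \<Longrightarrow> norm u < \<delta> \<Longrightarrow> \<exists>g\<in>hnormals E. dist e0 g \<le> \<rho> / 2 \<and> P g = u"
begin

definition U :: "'a set" where "U = {u \<in> L. norm u < \<delta>}"

definition hchart :: "'a set \<Rightarrow> 'a \<Rightarrow> 'a" where
  "hchart b u = (SOME g. g \<in> hnormals b \<and> dist e0 g \<le> \<rho> / 2 \<and> P g = u)"

lemma WB: "b \<in> W \<Longrightarrow> b \<in> BB" using W by blast

lemma hchart:
  assumes "b \<in> W" "u \<in> U"
  shows "hchart b u \<in> hnormals b" "dist e0 (hchart b u) \<le> \<rho> / 2" "P (hchart b u) = u"
proof -
  have "\<exists>g. g \<in> hnormals b \<and> dist e0 g \<le> \<rho> / 2 \<and> P g = u"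
    using ex[OF assms(1), of u] assms(2) by (auto simp: U_def)
  from someI_ex[OF this]
  show "hchart b u \<in> hnormals b" "dist e0 (hchart b u) \<le> \<rho> / 2" "P (hchart b u) = u"
    unfolding hchart_def by auto
qed

lemma hchart_near: "b \<in> W \<Longrightarrow> u \<in> U \<Longrightarrow> dist e0 (hchart b u) < \<rho>"
  using hchart(2)[of b u] pos by linarith

lemma hchart_eq:
  assumes "b \<in> W" "g \<in> hnormals b" "dist e0 g < \<rho>" "P g \<in> U"
  shows "hchart b (P g) = g"
proof -
  have "norm (hchart b (P g) - g) \<le> 2 * norm (P (hchart b (P g) - g))"
    using lower hchart hchart_near assms by blast
  also have "\<dots> = 0" using hchart(3)[OF assms(1,4)] by (simp add: P.diff)
  finally show ?thesis by simp
qed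

lemma hchart_nonzero: "b \<in> W \<Longrightarrow> u \<in> U \<Longrightarrow> hchart b u \<noteq> 0"
  using hchart(1)[of b u] by (auto simp: hnormals_def)

lemma hchart_normals: "b \<in> W \<Longrightarrow> u \<in> U \<Longrightarrow> hchart b u \<in> normals b"
  using hchart(1)[of b u] by (auto simp: hnormals_def)

text \<open>Any limit point is a normal in the slice within \<rho> / 2 of \<open>e0\<close> and with
  coordinate \<open>u\<close>; injectivity of the coordinate leaves only one.\<close>

lemma hchart_tendsto:
  assumes s: "\<And>n. s n \<in> W" "set_converges s b" "b \<in> W" and v: "\<And>n. v n \<in> U" "v \<longlonglongrightarrow> u" "u \<in> U"
  shows "(\<lambda>n. hchart (s n) (v n)) \<longlonglongrightarrow> hchart b u"
proof (rule tendsto_via_limit_points)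
  show "norm (hchart (s n) (v n)) \<le> norm e0 + \<rho>" for n
    using hchart_near[OF s(1) v(1), of n n] norm_triangle_sub[of "hchart (s n) (v n)" e0]
    by (simp add: dist_norm norm_minus_commute)
  fix f l assume f: "strict_mono f" and l: "(\<lambda>n. hchart (s (f n)) (v (f n))) \<longlonglongrightarrow> l"
  have A: "fconv (\<lambda>n. s (f n)) b"
    using fconv_subseq[OF fconvI[OF _ _ s(2)] f] WB s by blast
  have "(\<lambda>n. hchart (s (f n)) (v (f n)) \<bullet> e0) \<longlonglongrightarrow> l \<bullet> e0" by (intro tendsto_inner l tendsto_const)
  then have le: "l \<bullet> e0 = 1" using hchart(1)[OF s(1) v(1)] by (simp add: hnormals_def LIMSEQ_const_iff)
  have "l \<in> normals b"
    by (rule normals_limit[OF A _ l]) (use hchart_normals s v le in auto)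
  then have "l \<in> hnormals b" using le by (simp add: hnormals_def)
  moreover have "(\<lambda>n. dist e0 (hchart (s (f n)) (v (f n)))) \<longlonglongrightarrow> dist e0 l" by (intro tendsto_dist l tendsto_const)
  then have "dist e0 l \<le> \<rho> / 2" by (rule LIMSEQ_le_const2) (use hchart(2) s v in auto)
  then have "dist e0 l < \<rho>" using pos by linarith
  moreover have "P l = u"
  proof (rule LIMSEQ_unique)
    show "(\<lambda>n. P (hchart (s (f n)) (v (f n)))) \<longlonglongrightarrow> P l" by (rule P.tendsto[OF l])
    show "(\<lambda>n. P (hchart (s (f n)) (v (f n)))) \<longlonglongrightarrow> u"
      using LIMSEQ_subseq_LIMSEQ[OF v(2) f] hchart(3)[OF s(1) v(1)] by (simp add: o_def)
  qed
  ultimately show "l = hchart b u" using hchart_eq[OF s(3), of l] v(3) by simp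
qed

text \<open>The inverse of \<open>P\<close> on the tangent space. Using \<open>P v\<close> in place
  of \<open>v\<close> makes it a linear map on all of the ambient space, as the type of bounded
  linear maps demands, and not only on \<open>L\<close>.\<close>

definition Dhchart :: "'a set \<Rightarrow> 'a \<Rightarrow> 'a \<Rightarrow> 'a" where
  "Dhchart b u v = (SOME w. w \<in> tang b (hchart b u) \<and> P w = P v)"

context
  fixes b u assumes b: "b \<in> W" and u: "u \<in> U"
begin

lemma lower_tang': "w \<in> tang b (hchart b u) \<Longrightarrow> norm w \<le> 2 * norm (P w)"
  using lower_tang[OF b hchart(1)[OF b u] hchart_near[OF b u]] .

lemma P_tang_inj: "w \<in> tang b (hchart b u) \<Longrightarrow> w' \<in> tang b (hchart b u) \<Longrightarrow> P w = P w' \<Longrightarrow> w = w'"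
  using lower_tang'[OF subspace_diff[OF subspace_tang], of w w'] by (simp add: P.diff)

lemma P_tang_surj: "P ` tang b (hchart b u) = L"
proof (rule subspace_dim_equal[OF linear_subspace_image[OF P.linear subspace_tang] subspace_L])
  have "inj_on P (span (tang b (hchart b u)))"
    using P_tang_inj by (simp add: span_eq_iff[THEN iffD2, OF subspace_tang] inj_on_def)
  then have "dim (P ` tang b (hchart b u)) = dim (tang b (hchart b u))"
    using dim_image_eq P.linear by blast
  also have "\<dots> = dim L" using dim_tang[OF WB[OF b] hchart(1)[OF b u]] dim_L by simp
  finally show "dim L \<le> dim (P ` tang b (hchart b u))" by simp
qed (auto simp: orth_proj[OF subspace_L])

lemma Dhchart: "Dhchart b u v \<in> tang b (hchart b u)" "P (Dhchart b u v) = P v"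
proof -
  have "P v \<in> P ` tang b (hchart b u)" using P_tang_surj orth_proj(1)[OF subspace_L] by blast
  then have "\<exists>w. w \<in> tang b (hchart b u) \<and> P w = P v" by force
  from someI_ex[OF this] show "Dhchart b u v \<in> tang b (hchart b u)" "P (Dhchart b u v) = P v"
    unfolding Dhchart_def by auto
qed

lemma Dhchart_eq: "w \<in> tang b (hchart b u) \<Longrightarrow> P w = P v \<Longrightarrow> Dhchart b u v = w"
  using P_tang_inj Dhchart by simp

lemma norm_Dhchart_le: "norm (Dhchart b u x) \<le> 2 * norm x"
  using lower_tang'[OF Dhchart(1), of x] norm_orth_proj_le[OF subspace_L, of x]
  by (simp add: Dhchart(2))

lemma bounded_linear_Dhchart: "bounded_linear (Dhchart b u)"
proof (rule bounded_linear_intro[of _ 2])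
  show "Dhchart b u (x + y) = Dhchart b u x + Dhchart b u y" for x y
    by (rule Dhchart_eq) (auto simp: Dhchart P.add intro: subspace_add[OF subspace_tang])
  show "Dhchart b u (c *\<^sub>R x) = c *\<^sub>R Dhchart b u x" for c x
    by (rule Dhchart_eq) (auto simp: Dhchart P.scaleR intro: subspace_scale[OF subspace_tang])
  show "norm (Dhchart b u x) \<le> norm x * 2" for x
    using norm_Dhchart_le[of x] by (simp add: mult.commute)
qed

end

lemma Dhchart_tendsto:
  assumes s: "\<And>n. s n \<in> W" "set_converges s b" "b \<in> W" and v: "\<And>n. v n \<in> U" "v \<longlonglongrightarrow> u" "u \<in> U"
  shows "(\<lambda>n. Dhchart (s n) (v n) x) \<longlonglongrightarrow> Dhchart b u x"
proof (rule tendsto_via_limit_points)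
  show "norm (Dhchart (s n) (v n) x) \<le> 2 * norm x" for n using norm_Dhchart_le s v by blast
  fix f l assume f: "strict_mono f" and l: "(\<lambda>n. Dhchart (s (f n)) (v (f n)) x) \<longlonglongrightarrow> l"
  have A: "fconv (\<lambda>n. s (f n)) b"
    using fconv_subseq[OF fconvI[OF _ _ s(2)] f] WB s by blast
  have "(\<lambda>n. hchart (s (f n)) (v (f n))) \<longlonglongrightarrow> hchart b u"
    using LIMSEQ_subseq_LIMSEQ[OF hchart_tendsto[OF s v] f] by (simp add: o_def)
  from tang_limit[OF A _ this _ _ l] have "l \<in> tang b (hchart b u)"
    using hchart_normals[OF s(1) v(1)] hchart_nonzero[OF s(3) v(3)] Dhchart(1)[OF s(1) v(1)] by simp
  moreover have "P l = P x"
    using P.tendsto[OF l] Dhchart(2)[OF s(1) v(1)] by (simp add: LIMSEQ_const_iff)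
  ultimately show "l = Dhchart b u x" using Dhchart_eq[OF s(3) v(3)] by simp
qed

text \<open>The remainder quotients are bounded by 4, namely 2 for the secants and 2 for the linear
  term. A limit point is a limit of secants minus a tangent vector, hence tangent, and
  \<open>P\<close> kills it because both terms have the same coordinate. \<open>P\<close> is
  injective on tangent vectors, so only 0 remains.\<close>

lemma hchart_has_derivative:
  assumes b: "b \<in> W" and u: "u \<in> U"
  shows "(hchart b has_derivative Dhchart b u) (at u within L)"
proof -
  interpret D: bounded_linear "Dhchart b u" by (rule bounded_linear_Dhchart[OF assms])
  let ?R = "\<lambda>y. (1 / norm (y - u)) *\<^sub>R (hchart b y - (hchart b u + Dhchart b u (y - u)))"
  have "(?R \<longlongrightarrow> 0) (at u within U)"
    unfolding tendsto_at_iff_sequentially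
  proof (intro allI impI)
    fix X assume X: "\<forall>i. X i \<in> U - {u}" "X \<longlonglongrightarrow> u"
    then have XU: "\<And>n. X n \<in> U" "\<And>n. X n \<noteq> u" by auto
    have PXu: "P (X n - u) = X n - u" for n
      using XU u by (intro orth_proj_id[OF subspace_L] subspace_diff[OF subspace_L]) (auto simp: U_def)
    have bd1: "norm (hchart b (X n) - hchart b u) \<le> 2 * norm (X n - u)" for n
      using lower[OF b hchart(1)[OF b u] hchart(1)[OF b XU(1)] hchart_near[OF b u] hchart_near[OF b XU(1)]]
      by (simp add: P.diff hchart(3)[OF b] XU u)
    have "norm (?R (X n)) \<le> 4" for n
    proof -
      have "norm (hchart b (X n) - (hchart b u + Dhchart b u (X n - u)))
          \<le> norm (hchart b (X n) - hchart b u) + norm (Dhchart b u (X n - u))"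
        using norm_triangle_ineq4[of "hchart b (X n) - hchart b u" "Dhchart b u (X n - u)"]
        by (simp add: algebra_simps)
      also have "\<dots> \<le> 4 * norm (X n - u)" using bd1[of n] norm_Dhchart_le[OF assms, of "X n - u"] by simp
      finally show ?thesis using XU(2)[of n] by (simp add: divide_le_eq)
    qed
    then have "(\<lambda>n. ?R (X n)) \<longlonglongrightarrow> 0"
    proof (rule tendsto_via_limit_points)
      fix f l assume f: "strict_mono f" and l: "(\<lambda>n. ?R (X (f n))) \<longlonglongrightarrow> l"
      have "norm (Dhchart b u (X n - u) /\<^sub>R norm (X n - u)) \<le> 2" for n
        using norm_Dhchart_le[OF assms, of "X n - u"] XU(2)[of n] by (simp add: divide_le_eq field_simps)
      then obtain h d where h: "strict_mono h"
          and d: "(\<lambda>n. Dhchart b u (X (f (h n)) - u) /\<^sub>R norm (X (f (h n)) - u)) \<longlonglongrightarrow> d"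
        using bounded_convergent_subseq[of "\<lambda>n. Dhchart b u (X (f n) - u) /\<^sub>R norm (X (f n) - u)" 2] by blast
      have "d \<in> tang b (hchart b u)"
        by (rule closed_sequentially[OF closed_subspace[OF subspace_tang] _ d])
          (auto intro: subspace_scale[OF subspace_tang] Dhchart[OF assms])
      have fh: "strict_mono (\<lambda>n. f (h n))" using strict_mono_o[OF f h] by (simp add: o_def)
      have lh: "(\<lambda>n. ?R (X (f (h n)))) \<longlonglongrightarrow> l" using LIMSEQ_subseq_LIMSEQ[OF l h] by (simp add: o_def)
      have Xfh: "(\<lambda>n. X (f (h n))) \<longlonglongrightarrow> u" using LIMSEQ_subseq_LIMSEQ[OF X(2) fh] by (simp add: o_def)
      have "(\<lambda>n. (hchart b (X (f (h n))) - hchart b u) /\<^sub>R norm (X (f (h n)) - u)) \<longlonglongrightarrow> l + d"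
        using tendsto_add[OF lh d] by (simp add: algebra_simps inverse_eq_divide)
      then have "l + d \<in> tang b (hchart b u)"
      proof (rule hsecant_limit[OF fconv_const, rotated -1])
        show "(\<lambda>n. hchart b (X (f (h n)))) \<longlonglongrightarrow> hchart b u"
          by (rule hchart_tendsto[OF b set_converges_const b XU(1) Xfh u])
      qed (use hchart(1)[OF b] XU u hchart_nonzero b BB_faces WB in auto)
      from subspace_diff[OF subspace_tang this \<open>d \<in> _\<close>] have "l \<in> tang b (hchart b u)" by simp
      moreover have "P l = 0"
      proof (rule LIMSEQ_unique[OF P.tendsto[OF l]])
        have "P (?R (X n)) = 0" for n
          using PXu[of n] unfolding P.scaleR P.diff P.add Dhchart(2)[OF assms] hchart(3)[OF b XU(1)] hchart(3)[OF assms]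
          by simp
        then show "(\<lambda>n. P (?R (X (f n)))) \<longlonglongrightarrow> 0" by simp
      qed
      ultimately show "l = 0" using lower_tang'[OF assms, of l] by simp
    qed
    then show "(?R \<circ> X) \<longlonglongrightarrow> 0" by (simp add: o_def)
  qed
  then have "(hchart b has_derivative Dhchart b u) (at u within U)"
    by (simp add: has_derivative_within D.bounded_linear_axioms)
  moreover have "at u within L = at u within U"
    by (rule at_within_nhd[of _ "ball 0 \<delta>"]) (use u in \<open>auto simp: U_def\<close>)
  ultimately show ?thesis by simp
qed

end

context face_gap
begin

lemma normals_scale:
  assumes "g \<in> normals E" "0 < c"
  shows "c *\<^sub>R g \<in> normals E"
proof -
  have "contact_face E (c *\<^sub>R g) = contact_face E g" using assms(2) by (auto simp: contact_face_def)
  then show ?thesis using assms by (auto simp: normals_def span_scale)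
qed

end

section \<open>From the affine slice back to unit vectors\<close>

context face_chart_nbhd
begin

definition chart :: "'a set \<Rightarrow> 'a \<Rightarrow> 'a" where
  "chart b u = sgn (hchart b u)"

text \<open>The chain rule: the derivative of \<open>sgn\<close> at \<open>hchart b u\<close>,
  applied to \<open>Dhchart b u v\<close>.\<close>

definition Dchart :: "'a set \<Rightarrow> 'a \<Rightarrow> 'a \<Rightarrow> 'a" where
  "Dchart b u v = Dhchart b u v /\<^sub>R norm (hchart b u)
     - ((hchart b u \<bullet> Dhchart b u v) / norm (hchart b u) ^ 3) *\<^sub>R hchart b u"

lemma chart_has_derivative:
  assumes "b \<in> W" "u \<in> U"
  shows "(chart b has_derivative Dchart b u) (at u within L)"
  using has_derivative_compose[OF hchart_has_derivative[OF assms] has_derivative_sgn[OF hchart_nonzero[OF assms]]]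
  unfolding chart_def[abs_def] Dchart_def[abs_def] .

text \<open>Pairing with \<open>e0\<close> separates the two terms: \<open>hchart\<close> pairs to 1
  and \<open>Dhchart\<close> to 0, so the radial coefficient vanishes and then the tangential
  term.\<close>

lemma Dchart_inj:
  assumes b: "b \<in> W" "u \<in> U" and v: "v \<in> L" "Dchart b u v = 0"
  shows "v = 0"
proof -
  let ?g = "hchart b u" and ?w = "Dhchart b u v"
  have ge: "?g \<bullet> e0 = 1" using hchart(1)[OF b] by (simp add: hnormals_def)
  have we: "?w \<bullet> e0 = 0" using Dhchart(1)[OF b] by (simp add: tang_def orth_def)
  have eq: "?w /\<^sub>R norm ?g = ((?g \<bullet> ?w) / norm ?g ^ 3) *\<^sub>R ?g" using v(2) by (simp add: Dchart_def)
  then have "(?w /\<^sub>R norm ?g) \<bullet> e0 = (((?g \<bullet> ?w) / norm ?g ^ 3) *\<^sub>R ?g) \<bullet> e0" by simp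
  then have "(?g \<bullet> ?w) / norm ?g ^ 3 = 0" using ge we by simp
  then have "?w /\<^sub>R norm ?g = 0" using eq by (metis scaleR_zero_left)
  then have "?w = 0" using hchart_nonzero[OF b] by simp
  then have "P v = 0" using Dhchart(2)[OF b, of v] by (simp add: P.zero)
  then show ?thesis using orth_proj_id[OF subspace_L v(1)] by simp
qed

lemma chart_tendsto:
  assumes "\<And>n. s n \<in> W" "set_converges s b" "b \<in> W" "\<And>n. v n \<in> U" "v \<longlonglongrightarrow> u" "u \<in> U"
  shows "(\<lambda>n. chart (s n) (v n)) \<longlonglongrightarrow> chart b u"
  unfolding chart_def by (rule tendsto_sgn[OF hchart_tendsto[OF assms] hchart_nonzero[OF assms(3,6)]])

lemma Dchart_tendsto:
  assumes "\<And>n. s n \<in> W" "set_converges s b" "b \<in> W" "\<And>n. v n \<in> U" "v \<longlonglongrightarrow> u" "u \<in> U"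
  shows "(\<lambda>n. Blinfun (Dchart (s n) (v n))) \<longlonglongrightarrow> Blinfun (Dchart b u)"
proof (rule tendsto_componentwise1)
  have bl: "bounded_linear (Dchart b u)" if "b \<in> W" "u \<in> U" for b u
    using chart_has_derivative[OF that] by (rule has_derivative_bounded_linear)
  fix x
  have "(\<lambda>n. Dchart (s n) (v n) x) \<longlonglongrightarrow> Dchart b u x"
    unfolding Dchart_def
    by (intro tendsto_intros hchart_tendsto[OF assms] Dhchart_tendsto[OF assms])
      (use hchart_nonzero[OF assms(3,6)] in auto)
  then show "(\<lambda>n. Blinfun (Dchart (s n) (v n)) x) \<longlonglongrightarrow> Blinfun (Dchart b u) x"
    by (simp add: bounded_linear_Blinfun_apply bl assms)
qed

text \<open>The open conditions say that x / (x \<bullet> e0) is within \<rho> of \<open>e0\<close>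
  and has coordinate in \<open>U\<close>. Multiplied by x \<bullet> e0 they are free of
  division.\<close>

lemma chart_homeomorphism:
  assumes b: "b \<in> W"
  shows "homeomorphism U
      ({x \<in> normals b. norm x = 1} \<inter> {x. 0 < x \<bullet> e0 \<and> norm (x - (x \<bullet> e0) *\<^sub>R e0) < \<rho> * (x \<bullet> e0) \<and>
        norm (P x) < \<delta> * (x \<bullet> e0)})
      (chart b) (\<lambda>x. P x /\<^sub>R (x \<bullet> e0))"
proof (rule homeomorphismI)
  let ?T = "{x \<in> normals b. norm x = 1} \<inter> {x. 0 < x \<bullet> e0 \<and> norm (x - (x \<bullet> e0) *\<^sub>R e0) < \<rho> * (x \<bullet> e0) \<and>
        norm (P x) < \<delta> * (x \<bullet> e0)}"
  show "continuous_on U (chart b)"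
    unfolding continuous_on_sequentially
    using chart_tendsto[OF b set_converges_const b] by (auto simp: o_def)
  show "continuous_on ?T (\<lambda>x. P x /\<^sub>R (x \<bullet> e0))"
    by (intro continuous_intros P.continuous_on) auto
  show "chart b ` U \<subseteq> ?T"
  proof clarify
    fix u assume u: "u \<in> U"
    let ?g = "hchart b u"
    have N: "0 < norm ?g" using hchart_nonzero[OF b u] by simp
    have ge: "?g \<bullet> e0 = 1" using hchart(1)[OF b u] by (simp add: hnormals_def)
    have x: "chart b u = ?g /\<^sub>R norm ?g" by (simp add: chart_def sgn_div_norm)
    have xe: "chart b u \<bullet> e0 = inverse (norm ?g)" by (simp add: x ge)
    have "chart b u - (chart b u \<bullet> e0) *\<^sub>R e0 = inverse (norm ?g) *\<^sub>R (?g - e0)"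
      unfolding xe by (simp add: x scaleR_diff_right)
    then have "norm (chart b u - (chart b u \<bullet> e0) *\<^sub>R e0) = inverse (norm ?g) * dist e0 ?g"
      by (simp add: dist_norm norm_minus_commute)
    also have "\<dots> < inverse (norm ?g) * \<rho>" using hchart_near[OF b u] N by simp
    finally have "norm (chart b u - (chart b u \<bullet> e0) *\<^sub>R e0) < \<rho> * (chart b u \<bullet> e0)"
      unfolding xe by (simp add: mult.commute)
    moreover have "norm (P (chart b u)) < \<delta> * (chart b u \<bullet> e0)"
      using u N by (simp add: x ge P.scaleR hchart(3)[OF b u] U_def field_simps)
    moreover have "chart b u \<in> normals b"
      unfolding x using normals_scale[OF hchart_normals[OF b u]] N by simp
    moreover have "norm (chart b u) = 1" using N by (simp add: chart_def norm_sgn)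
    ultimately show "chart b u \<in> ?T" using N by (simp add: xe)
  qed
  have key: "P y /\<^sub>R (y \<bullet> e0) \<in> U \<and> chart b (P y /\<^sub>R (y \<bullet> e0)) = y" if y: "y \<in> ?T" for y
  proof -
    let ?g = "y /\<^sub>R (y \<bullet> e0)"
    have ye: "0 < y \<bullet> e0" and ny: "norm y = 1" using y by auto
    have g: "?g \<in> hnormals b" using normals_scale[of y b "inverse (y \<bullet> e0)"] y ye by (simp add: hnormals_def)
    have "e0 - ?g = - (inverse (y \<bullet> e0) *\<^sub>R (y - (y \<bullet> e0) *\<^sub>R e0))" using ye by (simp add: scaleR_diff_right)
    then have "dist e0 ?g = inverse (y \<bullet> e0) * norm (y - (y \<bullet> e0) *\<^sub>R e0)"
      using ye by (simp only: dist_norm norm_minus_cancel norm_scaleR) simp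
    also have "\<dots> < \<rho>" using y ye by (simp add: field_simps)
    finally have "dist e0 ?g < \<rho>" .
    moreover have Pg: "P ?g = P y /\<^sub>R (y \<bullet> e0)" by (simp add: P.scaleR)
    moreover have "P ?g \<in> U"
    proof -
      have "norm (P ?g) = inverse (y \<bullet> e0) * norm (P y)" unfolding Pg using ye by simp
      also have "\<dots> < \<delta>" using y ye by (simp add: field_simps)
      finally show ?thesis using orth_proj(1)[OF subspace_L] by (simp add: U_def)
    qed
    ultimately have "hchart b (P y /\<^sub>R (y \<bullet> e0)) = ?g" using hchart_eq[OF b g] by simp
    then have "chart b (P y /\<^sub>R (y \<bullet> e0)) = sgn ?g" by (simp add: chart_def)
    also have "\<dots> = y" using ye ny by (simp add: sgn_scaleR sgn_div_norm)
    finally show ?thesis using \<open>P ?g \<in> U\<close> Pg by simp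
  qed
  then show "(\<lambda>x. P x /\<^sub>R (x \<bullet> e0)) ` ?T \<subseteq> U" "\<And>y. y \<in> ?T \<Longrightarrow> chart b (P y /\<^sub>R (y \<bullet> e0)) = y" by blast+
  fix u assume u: "u \<in> U"
  have N: "norm (hchart b u) \<noteq> 0" using hchart_nonzero[OF b u] by simp
  have "hchart b u \<bullet> e0 = 1" using hchart(1)[OF b u] by (simp add: hnormals_def)
  then show "P (chart b u) /\<^sub>R (chart b u \<bullet> e0) = u"
    using N by (simp add: chart_def sgn_div_norm P.scaleR hchart(3)[OF b u])
qed

text \<open>Failures occur at points of the compact \<open>K\<close>. Along a subsequence these
  converge, and both the moving and the fixed chart then tend to the values at the limit point, by
  joint continuity.\<close>

lemma chart_uniform:
  assumes b: "b \<in> W" and K: "compact K" "K \<subseteq> U" and "0 < \<epsilon>"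
  obtains N where "openin (subtopology fell_topology BB) N" "b \<in> N"
    "\<And>b' u. b' \<in> N \<inter> W \<Longrightarrow> u \<in> K \<Longrightarrow> dist (chart b' u) (chart b u) < \<epsilon> \<and>
      norm (Blinfun (Dchart b' u) - Blinfun (Dchart b u)) < \<epsilon>"
proof -
  define Q where "Q b' \<longleftrightarrow> (b' \<in> W \<longrightarrow> (\<forall>u\<in>K. dist (chart b' u) (chart b u) < \<epsilon> \<and>
      norm (Blinfun (Dchart b' u) - Blinfun (Dchart b u)) < \<epsilon>))" for b'
  obtain k N where "openin (subtopology fell_topology BB) N" "b \<in> N" "\<And>A. A \<in> N \<Longrightarrow> Q A"
  proof (rule fell_neighbourhood_via_sequences[OF BB_closed WB[OF b], of "\<lambda>k. Q"])
    fix s assume s: "\<And>k. s k \<in> BB" "set_converges s b"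
    show "\<exists>k::nat. Q (s k)"
    proof (rule ccontr)
      assume "\<nexists>k. Q (s k)"
      then obtain u where sW: "\<And>k. s k \<in> W" and u: "\<And>k. u k \<in> K"
        and no: "\<And>k. \<not> (dist (chart (s k) (u k)) (chart b (u k)) < \<epsilon> \<and>
          norm (Blinfun (Dchart (s k) (u k)) - Blinfun (Dchart b (u k))) < \<epsilon>)"
        unfolding Q_def by metis
      obtain l f where l: "l \<in> K" "strict_mono f" "(u \<circ> f) \<longlonglongrightarrow> l"
        using K(1) u unfolding compact_def by metis
      have uf: "\<And>n. u (f n) \<in> U" "(\<lambda>n. u (f n)) \<longlonglongrightarrow> l" "l \<in> U" using u K l by (auto simp: o_def)
      have sf: "\<And>n. s (f n) \<in> W" "set_converges (\<lambda>n. s (f n)) b"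
        using sW set_converges_subseq[OF s(2) l(2)] by auto
      have "(\<lambda>n. dist (chart (s (f n)) (u (f n))) (chart b (u (f n)))) \<longlonglongrightarrow> dist (chart b l) (chart b l)"
        by (intro tendsto_dist chart_tendsto[OF sf b uf] chart_tendsto[OF b set_converges_const b uf])
      then have "\<forall>\<^sub>F n in sequentially. dist (chart (s (f n)) (u (f n))) (chart b (u (f n))) < \<epsilon>"
        using order_tendstoD(2)[of _ 0] \<open>0 < \<epsilon>\<close> by simp
      moreover have "(\<lambda>n. norm (Blinfun (Dchart (s (f n)) (u (f n))) - Blinfun (Dchart b (u (f n)))))
          \<longlonglongrightarrow> norm (Blinfun (Dchart b l) - Blinfun (Dchart b l))"
        by (intro tendsto_norm tendsto_diff Dchart_tendsto[OF sf b uf] Dchart_tendsto[OF b set_converges_const b uf])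
      then have "\<forall>\<^sub>F n in sequentially.
          norm (Blinfun (Dchart (s (f n)) (u (f n))) - Blinfun (Dchart b (u (f n)))) < \<epsilon>"
        using order_tendstoD(2)[of _ 0] \<open>0 < \<epsilon>\<close> by simp
      ultimately have "\<forall>\<^sub>F n in sequentially. False" by eventually_elim (use no in blast)
      then show False by simp
    qed
  qed blast
  then show ?thesis using that by (simp add: Q_def)
qed

lemma local_parametrisation:
  assumes op: "openin (subtopology fell_topology BB) W"
    and S: "\<And>b x. b \<in> W \<Longrightarrow> (b, x) \<in> S \<longleftrightarrow> x \<in> normals b \<and> norm x = 1"
  shows "\<exists>W V L U \<phi> D.
        openin (subtopology fell_topology BB) W \<and> E0 \<in> W \<and> open V \<and> e0 \<in> V \<and>
        subspace (L::'a set) \<and> dim L = r - m - 1 \<and> openin (top_of_set L) U \<and>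
        (\<forall>b\<in>W.
           (\<forall>u\<in>U. (\<phi> b has_derivative blinfun_apply (D b u)) (at u within L) \<and>
                   (\<forall>v\<in>L. blinfun_apply (D b u) v = 0 \<longrightarrow> v = 0)) \<and>
           continuous_on U (D b) \<and>
           (\<exists>g. homeomorphism U ({x. (b, x) \<in> S} \<inter> V) (\<phi> b) g)) \<and>
        (\<forall>b\<in>W. \<forall>K. compact K \<and> K \<subseteq> U \<longrightarrow>
           (\<forall>\<epsilon>>0. \<exists>N. openin (subtopology fell_topology BB) N \<and> b \<in> N \<and>
              (\<forall>b'\<in>N \<inter> W. \<forall>u\<in>K. dist (\<phi> b' u) (\<phi> b u) < \<epsilon> \<and> norm (D b' u - D b u) < \<epsilon>)))"
proof -
  let ?V = "{x. 0 < x \<bullet> e0 \<and> norm (x - (x \<bullet> e0) *\<^sub>R e0) < \<rho> * (x \<bullet> e0) \<and> norm (P x) < \<delta> * (x \<bullet> e0)}"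
  let ?D = "\<lambda>b u. Blinfun (Dchart b u)"
  show ?thesis
  proof (rule exI[of _ W], rule exI[of _ ?V], rule exI[of _ L], rule exI[of _ U], rule exI[of _ chart],
      rule exI[of _ ?D], intro conjI ballI)
    show "open ?V"
      by (intro open_Collect_conj open_Collect_less continuous_intros P.continuous_on)
    show "e0 \<in> ?V" using pos by (simp add: e0_inner P_e0)
    have "U = L \<inter> ball 0 \<delta>" by (auto simp: U_def)
    then show "openin (top_of_set L) U" by (simp add: openin_open_Int)
    show "openin (subtopology fell_topology BB) W" "E0 \<in> W" "subspace L" "dim L = r - m - 1"
      by (rule op W(2) subspace_L dim_L)+
  next
    fix b u assume bu: "b \<in> W" "u \<in> U"
    have "bounded_linear (Dchart b u)"
      using chart_has_derivative[OF bu] by (rule has_derivative_bounded_linear)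
    then have D: "blinfun_apply (?D b u) = Dchart b u" by (rule bounded_linear_Blinfun_apply)
    show "(chart b has_derivative blinfun_apply (?D b u)) (at u within L)"
      unfolding D by (rule chart_has_derivative[OF bu])
    show "blinfun_apply (?D b u) v = 0 \<longrightarrow> v = 0" if "v \<in> L" for v
      unfolding D using Dchart_inj[OF bu that] by blast
  next
    fix b assume b: "b \<in> W"
    show "continuous_on U (?D b)"
      unfolding continuous_on_sequentially
      using Dchart_tendsto[OF b set_converges_const b] by (auto simp: o_def)
    show "\<exists>g. homeomorphism U ({x. (b, x) \<in> S} \<inter> ?V) (chart b) g"
      using chart_homeomorphism[OF b] unfolding S[OF b] by blast
    show "\<forall>K. compact K \<and> K \<subseteq> U \<longrightarrow>
           (\<forall>\<epsilon>>0. \<exists>N. openin (subtopology fell_topology BB) N \<and> b \<in> N \<and>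
              (\<forall>b'\<in>N \<inter> W. \<forall>u\<in>K. dist (chart b' u) (chart b u) < \<epsilon> \<and> norm (?D b' u - ?D b u) < \<epsilon>))"
    proof (intro allI impI)
      fix K and \<epsilon> :: real assume "compact K \<and> K \<subseteq> U" "0 < \<epsilon>"
      then obtain N where "openin (subtopology fell_topology BB) N" "b \<in> N"
        "\<And>b' u. b' \<in> N \<inter> W \<Longrightarrow> u \<in> K \<Longrightarrow> dist (chart b' u) (chart b u) < \<epsilon> \<and> norm (?D b' u - ?D b u) < \<epsilon>"
        using chart_uniform[OF b, of K \<epsilon>] by blast
      then show "\<exists>N. openin (subtopology fell_topology BB) N \<and> b \<in> N \<and>
              (\<forall>b'\<in>N \<inter> W. \<forall>u\<in>K. dist (chart b' u) (chart b u) < \<epsilon> \<and> norm (?D b' u - ?D b u) < \<epsilon>)"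
        by blast
    qed
  qed
qed

text \<open>The curve is the chart along a line through 0. Its velocity is \<open>v\<close>: at the
  base point \<open>Dhchart\<close> is the identity on \<open>L\<close>, and the radial term
  vanishes because \<open>v\<close> is orthogonal to \<open>e0\<close>.\<close>

lemma tangent_space_supset: "L \<subseteq> tangent_space {x \<in> normals E0. norm x = 1} e0"
proof
  fix v assume v: "v \<in> L"
  have U0: "0 \<in> U" using pos subspace_0[OF subspace_L] by (simp add: U_def)
  have h0: "hchart E0 0 = e0"
    using hchart_eq[OF W(2) e0_hnormals] pos U0 by (simp add: P_e0)
  have "Dhchart E0 0 v = v"
    by (rule Dhchart_eq[OF W(2) U0]) (simp_all add: h0 tang_e0 v)
  then have Dv: "Dchart E0 0 v = v"
    using v e0(2) by (simp add: Dchart_def h0 L_def orth_def inner_commute)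
  define \<gamma> where "\<gamma> t = chart E0 (t *\<^sub>R v)" for t :: real
  have "(chart E0 has_derivative Dchart E0 0) (at (0 *\<^sub>R v) within range (\<lambda>t. t *\<^sub>R v))"
    using has_derivative_subset[OF chart_has_derivative[OF W(2) U0], of "range (\<lambda>t. t *\<^sub>R v)"]
      v subspace_scale[OF subspace_L] by auto
  from has_derivative_in_compose[OF bounded_linear_imp_has_derivative[OF bounded_linear_scaleR_left] this]
  have "(\<gamma> has_derivative (\<lambda>t. Dchart E0 0 (t *\<^sub>R v))) (at 0)"
    by (simp add: \<gamma>_def[abs_def])
  moreover have "Dchart E0 0 (t *\<^sub>R v) = t *\<^sub>R v" for t
    using linear_scale[OF has_derivative_linear[OF chart_has_derivative[OF W(2) U0]], of t v] Dv by simp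
  ultimately have "(\<gamma> has_vector_derivative v) (at 0)" by (simp add: has_vector_derivative_def)
  moreover have "\<gamma> 0 = e0" using e0(2) by (simp add: \<gamma>_def chart_def h0 sgn_div_norm)
  moreover have "\<gamma> t \<in> {x \<in> normals E0. norm x = 1}" if t: "\<bar>t\<bar> < \<delta> / (norm v + 1)" for t
  proof -
    have "\<bar>t\<bar> * (norm v + 1) < \<delta>" using t by (simp add: pos_less_divide_eq add_nonneg_pos)
    then have "norm (t *\<^sub>R v) < \<delta>" by (simp add: distrib_left)
    then have "t *\<^sub>R v \<in> U" using v subspace_scale[OF subspace_L] by (simp add: U_def)
    then show ?thesis using chart_homeomorphism[OF W(2)] unfolding homeomorphism_def \<gamma>_def by blast
  qed
  moreover have "0 < \<delta> / (norm v + 1)" using pos by (simp add: add_nonneg_pos)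
  ultimately show "v \<in> tangent_space {x \<in> normals E0. norm x = 1} e0"
    unfolding tangent_space_def by blast
qed

end

section \<open>Existence of chart neighbourhoods and the fibrewise tangent space\<close>

context face_chart
begin

lemma ex_face_chart_nbhd:
  obtains \<rho> \<delta> W where "face_chart_nbhd C r m BB E0 e0 \<rho> \<delta> W" "openin (subtopology fell_topology BB) W"
proof -
  let ?T = "subtopology fell_topology BB"
  obtain \<rho>1 N1 where 1: "0 < \<rho>1" "openin ?T N1" "E0 \<in> N1"
    "\<And>E g g'. E \<in> N1 \<Longrightarrow> g \<in> hnormals E \<Longrightarrow> g' \<in> hnormals E \<Longrightarrow> dist e0 g < \<rho>1 \<Longrightarrow> dist e0 g' < \<rho>1 \<Longrightarrow>
      norm (g' - g) \<le> 2 * norm (P (g' - g))" by (rule hnormals_lower_bound) blast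
  obtain \<rho>2 N2 where 2: "0 < \<rho>2" "openin ?T N2" "E0 \<in> N2"
    "\<And>E g w. E \<in> N2 \<Longrightarrow> g \<in> hnormals E \<Longrightarrow> dist e0 g < \<rho>2 \<Longrightarrow> w \<in> tang E g \<Longrightarrow> norm w \<le> 2 * norm (P w)"
    by (rule tang_lower_bound) blast
  define \<rho> where "\<rho> = min \<rho>1 \<rho>2"
  have "0 < \<rho>" using 1 2 by (simp add: \<rho>_def)
  obtain \<delta> N3 where 3: "0 < \<delta>" "openin ?T N3" "E0 \<in> N3"
    "\<And>E u. E \<in> N3 \<Longrightarrow> u \<in> L \<Longrightarrow> norm u < \<delta> \<Longrightarrow> \<exists>g\<in>hnormals E. dist e0 g \<le> \<rho> / 2 \<and> P g = u"
    by (rule hnormals_exist[OF \<open>0 < \<rho>\<close>]) blast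
  let ?W = "N1 \<inter> N2 \<inter> N3"
  have "openin ?T ?W" using 1 2 3 by blast
  moreover have "face_chart_nbhd C r m BB E0 e0 \<rho> \<delta> ?W"
  proof unfold_locales
    show "?W \<subseteq> BB" using openin_subset[OF 1(2)] by auto
  qed (use 1 2 3 \<open>0 < \<rho>\<close> in \<open>auto simp: \<rho>_def\<close>)
  ultimately show ?thesis using that by blast
qed

text \<open>For the upper inclusion, pairing a curve with a point of the contact face has a minimum
  at time 0, and pairing it with \<open>e0\<close> has a maximum by Cauchy-Schwarz. The curve is
  unchanged by projection to the span, so its velocity lies there too.\<close>

lemma tangent_space_normals:
  "tangent_space {x \<in> normals E0. norm x = 1} e0 = L"
proof
  obtain \<rho> \<delta> W where "face_chart_nbhd C r m BB E0 e0 \<rho> \<delta> W" by (rule ex_face_chart_nbhd) blast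
  then interpret face_chart_nbhd C r m BB E0 e0 \<rho> \<delta> W .
  show "L \<subseteq> tangent_space {x \<in> normals E0. norm x = 1} e0" by (rule tangent_space_supset)
  show "tangent_space {x \<in> normals E0. norm x = 1} e0 \<subseteq> L"
  proof
    fix v assume "v \<in> tangent_space {x \<in> normals E0. norm x = 1} e0"
    then obtain \<gamma> and \<epsilon> :: real where \<epsilon>: "0 < \<epsilon>" and \<gamma>0: "\<gamma> 0 = e0"
      and \<gamma>: "\<And>t. \<bar>t\<bar> < \<epsilon> \<Longrightarrow> \<gamma> t \<in> normals E0 \<and> norm (\<gamma> t) = 1"
      and d: "(\<gamma> has_vector_derivative v) (at 0)"
      unfolding tangent_space_def by blast
    have inner: "((\<lambda>t. \<gamma> t \<bullet> z) has_real_derivative v \<bullet> z) (at 0)" for z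
      using bounded_linear.has_vector_derivative[OF bounded_linear_inner_left[of z] d]
      by (simp add: has_real_derivative_iff_has_vector_derivative)
    have "v \<bullet> z = 0" if z: "z \<in> contact_face E0 e0" for z
    proof (rule DERIV_local_min[OF inner \<epsilon>], intro allI impI)
      fix t assume "\<bar>0 - t\<bar> < \<epsilon>"
      then have "0 \<le> \<gamma> t \<bullet> z" using \<gamma>[of t] z by (auto simp: normals_def contact_face_def)
      then show "\<gamma> 0 \<bullet> z \<le> \<gamma> t \<bullet> z" using z by (simp add: \<gamma>0 contact_face_def)
    qed
    moreover have "v \<bullet> e0 = 0"
    proof (rule DERIV_local_max[OF inner \<epsilon>], intro allI impI)
      fix t assume "\<bar>0 - t\<bar> < \<epsilon>"
      then have "\<gamma> t \<bullet> e0 \<le> 1" using \<gamma>[of t] norm_cauchy_schwarz[of "\<gamma> t" e0] e0(2) by simp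
      then show "\<gamma> t \<bullet> e0 \<le> \<gamma> 0 \<bullet> e0" by (simp add: \<gamma>0 e0_inner)
    qed
    moreover have "v \<in> span E0"
    proof -
      have "((\<lambda>t. orth_proj (span E0) (\<gamma> t)) has_vector_derivative orth_proj (span E0) v) (at 0)"
        by (rule bounded_linear.has_vector_derivative[OF bounded_linear_orth_proj[OF subspace_span] d])
      then have "(\<gamma> has_vector_derivative orth_proj (span E0) v) (at 0)"
      proof (rule has_vector_derivative_transform_within_open[of _ _ _ "ball 0 \<epsilon>"])
        fix t :: real assume "t \<in> ball 0 \<epsilon>"
        then have "\<gamma> t \<in> span E0" using \<gamma>[of t] by (simp add: normals_def dist_norm)
        then show "orth_proj (span E0) (\<gamma> t) = \<gamma> t" by (rule orth_proj_id[OF subspace_span])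
      qed (use \<epsilon> in auto)
      then have "orth_proj (span E0) v = v" using d vector_derivative_unique_at by blast
      then show ?thesis using orth_proj(1)[OF subspace_span, of E0 v] by simp
    qed
    ultimately show "v \<in> L" by (simp add: L_def orth_def)
  qed
qed

end

section \<open>Regular points and exposing normals\<close>

lemma parallel_of_equal_kernel:
  fixes y y' :: "'a::euclidean_space"
  assumes "y \<in> span E" "y' \<in> span E" "y \<noteq> 0"
    and "{z \<in> span E. y \<bullet> z = 0} = {z \<in> span E. y' \<bullet> z = 0}"
  shows "y' = ((y' \<bullet> y) / (y \<bullet> y)) *\<^sub>R y"
proof -
  let ?z = "y' - ((y' \<bullet> y) / (y \<bullet> y)) *\<^sub>R y"
  have z: "?z \<in> span E" using assms by (intro span_diff span_scale)
  have yz: "y \<bullet> ?z = 0" using assms(3) by (simp add: inner_diff_right inner_commute)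
  then have "?z \<in> {z \<in> span E. y' \<bullet> z = 0}" using z assms(4) by blast
  then have "y' \<bullet> ?z = 0" by blast
  then have "?z \<bullet> ?z = 0" using yz
    by (metis diff_zero inner_diff_left inner_scaleR_left mult_zero_right)
  then show ?thesis by simp
qed

context face_gap
begin

text \<open>The contact face of \<open>y\<close> is a face meeting the relative interior of
  \<open>F\<close>, so it contains \<open>F\<close>.\<close>

lemma dual_orth_of_rel_interior:
  assumes "E \<in> faces C" "F \<in> faces C" "x \<in> rel_interior F" "\<And>z. z \<in> E \<Longrightarrow> 0 \<le> y \<bullet> z" "y \<bullet> x = 0" "x \<in> E"
  shows "y \<in> orth F"
proof -
  have "contact_face E y face_of C"
    using contact_face_in_faces[OF assms(1,4)] by (simp add: faces_def)
  moreover have "x \<in> contact_face E y" using assms by (simp add: contact_face_def)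
  ultimately have "F \<subseteq> contact_face E y"
    using subset_of_face_of[of "contact_face E y" C F] assms(2,3) face_props(5) by blast
  then show ?thesis by (auto simp: orth_def contact_face_def)
qed

text \<open>Every nonzero element of the intersection gives a supporting hyperplane at
  \<open>x\<close>, so uniqueness makes all of them parallel. Opposite signs would force the
  functional to vanish on \<open>E\<close>, although it lies in the span of
  \<open>E\<close>.\<close>

lemma regular_point_ray:
  assumes E: "E \<in> faces C" and F: "F \<in> faces C" "F \<subseteq> E"
    and x: "x \<in> rel_interior F" and reg: "regular_point E x"
  shows "\<exists>e. norm e = 1 \<and> orth F \<inter> rel_dual_cone E = {t *\<^sub>R e | t. t \<ge> 0} \<and>
      {t *\<^sub>R e | t. t \<ge> 0} face_of rel_dual_cone E"
proof -
  have xE: "x \<in> E" using reg by (simp add: regular_point_def)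
  have xF: "x \<in> F" using x rel_interior_subset by blast
  have uniq: "H = H'" if "H \<in> supporting_hyperplanes E x" "H' \<in> supporting_hyperplanes E x" for H H'
    using reg that unfolding regular_point_def by blast
  have hyp: "{z \<in> span E. y \<bullet> z = 0} \<in> supporting_hyperplanes E x"
    if "y \<in> orth F \<inter> rel_dual_cone E" "y \<noteq> 0" for y
    unfolding supporting_hyperplanes_def mem_Collect_eq
    by (rule exI[of _ y], rule exI[of _ 0])
      (use that xF in \<open>auto simp: orth_def rel_dual_cone_def dual_cone_def\<close>)
  obtain y0 c where y0: "y0 \<in> span E" "y0 \<noteq> 0" "\<And>z. z \<in> E \<Longrightarrow> c \<le> y0 \<bullet> z" "y0 \<bullet> x = c"
    using reg unfolding regular_point_def supporting_hyperplanes_def by blast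
  \<comment> \<open>On a cone a supporting hyperplane at \<open>x\<close> passes through 0: compare
    with the points 0 and twice \<open>x\<close>.\<close>
  have "c \<le> 0" using y0(3)[OF face_props(3)[OF E]] by simp
  moreover have "c \<le> 2 * c" using y0(3)[OF face_props(4)[OF E xE, of 2]] y0(4) by simp
  ultimately have "c = 0" by simp
  then have pos0: "\<And>z. z \<in> E \<Longrightarrow> 0 \<le> y0 \<bullet> z" using y0 by blast
  have y0R: "y0 \<in> orth F \<inter> rel_dual_cone E"
    using dual_orth_of_rel_interior[OF E F(1) x pos0] y0 \<open>c = 0\<close> xE pos0
    by (simp add: rel_dual_cone_def dual_cone_def)
  define e where "e = sgn y0"
  have e1: "norm e = 1" using y0(2) by (simp add: e_def norm_sgn)
  have ray: "orth F \<inter> rel_dual_cone E = {t *\<^sub>R e | t. t \<ge> 0}"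
  proof
    show "{t *\<^sub>R e | t. t \<ge> 0} \<subseteq> orth F \<inter> rel_dual_cone E"
    proof clarify
      fix t :: real assume t: "0 \<le> t"
      have "t *\<^sub>R e = (t / norm y0) *\<^sub>R y0" by (simp add: e_def sgn_div_norm divide_inverse)
      moreover have "0 \<le> t / norm y0" using t by simp
      ultimately show "t *\<^sub>R e \<in> orth F \<inter> rel_dual_cone E"
        using y0R y0(1) t by (auto simp: orth_def rel_dual_cone_def dual_cone_def span_scale)
    qed
    show "orth F \<inter> rel_dual_cone E \<subseteq> {t *\<^sub>R e | t. t \<ge> 0}"
    proof
      fix y assume y: "y \<in> orth F \<inter> rel_dual_cone E"
      show "y \<in> {t *\<^sub>R e | t. t \<ge> 0}"
      proof (cases "y = 0")
        case True
        then show ?thesis by (auto intro!: exI[of _ 0])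
      next
        case False
        have ysp: "y \<in> span E" and ypos: "\<And>z. z \<in> E \<Longrightarrow> 0 \<le> y \<bullet> z"
          using y by (auto simp: rel_dual_cone_def dual_cone_def)
        define t where "t = (y \<bullet> y0) / (y0 \<bullet> y0)"
        have yt: "y = t *\<^sub>R y0"
          unfolding t_def
          by (rule parallel_of_equal_kernel[OF y0(1) ysp y0(2) uniq[OF hyp[OF y0R y0(2)] hyp[OF y False]]])
        have "0 \<le> t"
        proof (rule ccontr)
          assume "\<not> 0 \<le> t"
          then have "y0 \<bullet> z = 0" if "z \<in> E" for z
            using ypos[OF that] pos0[OF that] by (simp add: yt zero_le_mult_iff)
          then have "orthogonal y0 y0"
            using orthogonal_to_span[OF y0(1), of y0] by (simp add: orthogonal_def)
          with y0(2) show False by (simp add: orthogonal_self)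
        qed
        moreover have "y = (t * norm y0) *\<^sub>R e" using y0(2) by (simp add: yt e_def sgn_div_norm)
        ultimately show ?thesis by (auto intro!: exI[of _ "t * norm y0"])
      qed
    qed
  qed
  have "orth F \<inter> rel_dual_cone E face_of rel_dual_cone E"
    unfolding face_of_def
  proof (intro conjI ballI impI)
    show "convex (orth F \<inter> rel_dual_cone E)"
    proof (rule convexI)
      fix a b and p q :: real
      assume ab: "a \<in> orth F \<inter> rel_dual_cone E" "b \<in> orth F \<inter> rel_dual_cone E" "0 \<le> p" "0 \<le> q"
      then show "p *\<^sub>R a + q *\<^sub>R b \<in> orth F \<inter> rel_dual_cone E"
        by (auto simp: orth_def rel_dual_cone_def dual_cone_def inner_add_left span_add span_scale)
    qed
    fix a b x assume ab: "a \<in> rel_dual_cone E" "b \<in> rel_dual_cone E"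
      and x: "x \<in> orth F \<inter> rel_dual_cone E" "x \<in> open_segment a b"
    then obtain p where p: "0 < p" "p < 1" "x = (1 - p) *\<^sub>R a + p *\<^sub>R b" by (auto simp: in_segment)
    have "a \<bullet> f = 0 \<and> b \<bullet> f = 0" if f: "f \<in> F" for f
    proof -
      have nn: "0 \<le> (1 - p) * (a \<bullet> f)" "0 \<le> p * (b \<bullet> f)"
        using ab f F(2) p by (auto simp: rel_dual_cone_def dual_cone_def)
      have "(1 - p) * (a \<bullet> f) + p * (b \<bullet> f) = 0"
        using x(1) f p(3) by (auto simp: orth_def inner_add_left)
      then have "(1 - p) * (a \<bullet> f) = 0" "p * (b \<bullet> f) = 0" using nn by linarith+
      then show ?thesis using p by simp
    qed
    then show "a \<in> orth F \<inter> rel_dual_cone E" "b \<in> orth F \<inter> rel_dual_cone E"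
      using ab by (auto simp: orth_def)
  qed auto
  with e1 ray show ?thesis by auto
qed

text \<open>Regularity makes the choice in \<open>e_vec\<close> unique. Its contact face contains
  \<open>F\<close> and has dimension at most m, so it is \<open>F\<close> itself.\<close>

lemma e_vec_normals:
  assumes E: "E \<in> faces C" "dim E = r" and F: "F \<in> faces C" "dim F = m" "F \<subseteq> E"
    and reg: "\<And>x. x \<in> rel_interior F \<Longrightarrow> regular_point E x"
  shows "norm (e_vec E F) = 1" "e_vec E F \<in> normals E" "contact_face E (e_vec E F) = F"
    "y \<in> orth F \<inter> rel_dual_cone E \<Longrightarrow> norm y = 1 \<Longrightarrow> y = e_vec E F"
proof -
  obtain x where x: "x \<in> rel_interior F" using rel_interior_eq_empty face_props[OF F(1)] by blast
  let ?e = "e_vec E F"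
  have e: "norm ?e = 1" "orth F \<inter> rel_dual_cone E = {t *\<^sub>R ?e | t. t \<ge> 0}"
    using someI_ex[OF regular_point_ray[OF E(1) F(1,3) x reg[OF x]], folded e_vec_def] by auto
  have "1 *\<^sub>R ?e \<in> {t *\<^sub>R ?e | t. t \<ge> 0}" using zero_le_one by blast
  then have "?e \<in> orth F \<inter> rel_dual_cone E" unfolding e(2) by simp
  then have eF: "\<And>z. z \<in> F \<Longrightarrow> ?e \<bullet> z = 0" "?e \<in> span E" "\<And>z. z \<in> E \<Longrightarrow> 0 \<le> ?e \<bullet> z"
    by (auto simp: orth_def rel_dual_cone_def dual_cone_def)
  have "F \<subseteq> contact_face E ?e" using eF F(3) by (auto simp: contact_face_def)
  moreover have "dim (contact_face E ?e) \<le> m"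
    using contact_face_dim_le[OF E eF(3,2)] e(1) by fastforce
  ultimately show cf: "contact_face E ?e = F"
    using face_dim_less[OF contact_face_in_faces[OF E(1) eF(3)] F(1)] F(2) by fastforce
  then show "?e \<in> normals E" using eF F(2) by (simp add: normals_def)
  show "norm ?e = 1" by (rule e(1))
  assume "y \<in> orth F \<inter> rel_dual_cone E" "norm y = 1"
  then obtain t where "0 \<le> t" "y = t *\<^sub>R ?e" unfolding e(2) by blast
  with \<open>norm y = 1\<close> e(1) show "y = ?e" by simp
qed

text \<open>The unit norm keeps limits away from 0, where contact faces would jump.\<close>

lemma closedin_normals:
  assumes B: "B \<subseteq> {E \<in> faces C. dim E = r}"
  shows "closedin (prod_topology (subtopology fell_topology B) euclidean)
     {(E, x). E \<in> B \<and> x \<in> normals E \<and> norm x = 1}"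
proof -
  let ?T = "subtopology fell_topology B"
  let ?S = "{(E, x). E \<in> B \<and> x \<in> normals E \<and> norm x = 1}"
  have Bc: "B \<subseteq> {A. closed A \<and> A \<noteq> {}}" using B face_props(1,6) by blast
  have top: "topspace ?T = B" using Bc by (auto simp: topspace_fell)
  have "openin (prod_topology ?T euclidean) (B \<times> UNIV - ?S)"
    unfolding openin_prod_topology_alt
  proof (intro allI impI)
    fix b and x :: 'a assume bx: "(b, x) \<in> B \<times> UNIV - ?S"
    then have b: "b \<in> B" by blast
    define Q where "Q k E \<longleftrightarrow> (\<forall>x'. dist x x' < inverse (real (Suc k)) \<longrightarrow> (E, x') \<notin> ?S)" for k E
    obtain k N where N: "openin ?T N" "b \<in> N" "\<And>E. E \<in> N \<Longrightarrow> Q k E"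
    proof (rule fell_neighbourhood_via_sequences[OF Bc b, of Q])
      fix s assume s: "\<And>k. s k \<in> B" "set_converges s b"
      show "\<exists>k. Q k (s k)"
      proof (rule ccontr)
        assume "\<nexists>k. Q k (s k)"
        then have "\<forall>k. \<exists>y. dist x y < inverse (real (Suc k)) \<and> (s k, y) \<in> ?S"
          unfolding Q_def by blast
        from choice[OF this] obtain y
          where y: "\<And>k. dist x (y k) < inverse (real (Suc k))" "\<And>k. (s k, y k) \<in> ?S" by blast
        have lim: "y \<longlonglongrightarrow> x" by (rule tendsto_of_dist_less_inverse[OF y(1)])
        have nx: "norm x = 1" using tendsto_norm[OF lim] y(2) by (simp add: LIMSEQ_const_iff)
        have "fconv s b" using s b B by (auto simp: fconv_def)
        then have "x \<in> normals b" by (rule normals_limit[OF _ _ lim]) (use y(2) nx in auto)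
        with nx b bx show False by blast
      qed
    qed blast
    have "N \<subseteq> B" using openin_subset[OF N(1)] top by simp
    show "\<exists>U V. openin ?T U \<and> openin euclidean V \<and> b \<in> U \<and> x \<in> V \<and> U \<times> V \<subseteq> B \<times> UNIV - ?S"
    proof (intro exI[of _ N] exI[of _ "ball x (inverse (real (Suc k)))"] conjI N(1,2))
      show "N \<times> ball x (inverse (real (Suc k))) \<subseteq> B \<times> UNIV - ?S"
        using N(3) \<open>N \<subseteq> B\<close> unfolding Q_def by auto
    qed auto
  qed
  then show ?thesis
    unfolding closedin_def topspace_prod_topology top topspace_euclidean by auto
qed

lemma c10_submanifold_normals:
  assumes B: "B \<subseteq> {E \<in> faces C. dim E = r}"
  shows "c10_submanifold (subtopology fell_topology B) {(E, x). E \<in> B \<and> x \<in> normals E \<and> norm x = 1}"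
  unfolding c10_submanifold_def
proof (intro conjI closedin_normals[OF B] exI[of _ "r - m - 1"] ballI, clarify)
  fix E0 e0 assume "E0 \<in> B" "e0 \<in> normals E0" "norm e0 = 1"
  then interpret face_chart C r m B E0 e0
    using B by unfold_locales auto
  obtain \<rho> \<delta> W where nbhd: "face_chart_nbhd C r m B E0 e0 \<rho> \<delta> W" "openin (subtopology fell_topology B) W"
    by (rule ex_face_chart_nbhd) blast
  interpret face_chart_nbhd C r m B E0 e0 \<rho> \<delta> W by (rule nbhd(1))
  show "\<exists>W V L U \<phi> D.
        openin (subtopology fell_topology B) W \<and> E0 \<in> W \<and> open V \<and> e0 \<in> V \<and>
        subspace (L::'a set) \<and> dim L = r - m - 1 \<and> openin (top_of_set L) U \<and>
        (\<forall>b\<in>W.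
           (\<forall>u\<in>U. (\<phi> b has_derivative blinfun_apply (D b u)) (at u within L) \<and>
                   (\<forall>v\<in>L. blinfun_apply (D b u) v = 0 \<longrightarrow> v = 0)) \<and>
           continuous_on U (D b) \<and>
           (\<exists>g. homeomorphism U ({x. (b, x) \<in> {(E, x). E \<in> B \<and> x \<in> normals E \<and> norm x = 1}} \<inter> V) (\<phi> b) g)) \<and>
        (\<forall>b\<in>W. \<forall>K. compact K \<and> K \<subseteq> U \<longrightarrow>
           (\<forall>\<epsilon>>0. \<exists>N. openin (subtopology fell_topology B) N \<and> b \<in> N \<and>
              (\<forall>b'\<in>N \<inter> W. \<forall>u\<in>K. dist (\<phi> b' u) (\<phi> b u) < \<epsilon> \<and> norm (D b' u - D b u) < \<epsilon>)))"
    by (rule local_parametrisation[OF nbhd(2)]) (use WB in auto)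
qed

end

section \<open>Face dimensions\<close>

lemma finite_face_dims: "finite (face_dims C)"
proof (rule finite_subset)
  show "face_dims (C::'a::euclidean_space set) \<subseteq> {..DIM('a)}"
    by (auto simp: face_dims_def dim_subset_UNIV)
qed simp

lemma fdim_n_surj:
  assumes "s \<in> face_dims C"
  obtains i where "i \<le> fdepth C" "fdim_n C i = s"
proof -
  have "s \<in> set (sorted_list_of_set (face_dims C))" using assms finite_face_dims[of C] by simp
  then obtain i where "i < length (sorted_list_of_set (face_dims C))" "fdim_n C i = s"
    unfolding in_set_conv_nth fdim_n_def by blast
  then show ?thesis using that[of i] by (simp add: fdepth_def)
qed

lemma fdim_n_strict_mono:
  assumes "i < k" "k \<le> fdepth C" "face_dims C \<noteq> {}"
  shows "fdim_n C i < fdim_n C k"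
proof -
  have "0 < card (face_dims C)" using assms(3) finite_face_dims[of C] by (simp add: card_gt_0_iff)
  then have "k < length (sorted_list_of_set (face_dims C))" using assms(2) by (simp add: fdepth_def)
  then show ?thesis
    unfolding fdim_n_def using sorted_wrt_nth_less[OF sorted_list_of_set.strict_sorted_key_list_of_set] assms(1) by blast
qed

lemma dual_cone_closed_convex_cone:
  "closed (dual_cone A)" "convex (dual_cone A)" "cone (dual_cone A)"
proof -
  have "dual_cone A = (\<Inter>a\<in>A. {y. a \<bullet> y \<ge> 0})" by (auto simp: dual_cone_def inner_commute)
  then show "closed (dual_cone A)" by (auto intro!: closed_INT closed_halfspace_ge)
  show "convex (dual_cone A)" by (rule convexI) (auto simp: dual_cone_def inner_add_left)
  show "cone (dual_cone A)" by (auto simp: cone_def dual_cone_def)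
qed

lemma facially_compact_subseq:
  fixes H :: "nat \<Rightarrow> 'a::euclidean_space set"
  assumes "facially_compact C" "\<And>n. H n \<in> faces C" "\<And>n. dim (H n) = s"
  shows "\<exists>(f::nat \<Rightarrow> nat) A. strict_mono f \<and> A \<in> faces C \<and> dim A = s \<and> set_converges (\<lambda>n. H (f n)) A"
proof -
  have "s \<in> face_dims C" using assms(2,3) by (metis face_dims_def imageI)
  then obtain i where i: "i \<le> fdepth C" "fdim_n C i = s" by (rule fdim_n_surj)
  \<comment> \<open>Indices run backwards: the dimension with index i in increasing order belongs to
    the family with index d - i.\<close>
  let ?P = "Pfaces C (fdepth C - i)"
  have P: "?P = {F \<in> faces C. dim F = s}" using i by (simp add: Pfaces_def)
  have "compactin fell_topology ?P" using assms(1) i by (simp add: facially_compact_def)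
  moreover have "{} \<notin> ?P" by (auto simp: P faces_def)
  ultimately obtain f :: "nat \<Rightarrow> nat" and A where "strict_mono f" "A \<in> ?P" "set_converges (\<lambda>n. H (f n)) A"
    using compactin_fell_convergent_subseq[of ?P H] assms(2,3) P by blast
  then show ?thesis by (auto simp: P)
qed

theorem mainTheorem4:
  fixes \<Omega> :: "'a::euclidean_space set" and j :: nat
  assumes "closed \<Omega>" and "convex \<Omega>" and "cone \<Omega>"
    and "pointed_cone \<Omega>" and "solid \<Omega>"
    and "facially_compact (dual_cone \<Omega>)" and "locally_smooth (dual_cone \<Omega>)"
    and "1 \<le> j" and "j \<le> fdepth (dual_cone \<Omega>)"
  shows "let C = dual_cone \<Omega>;
             B = xi ` PP C j;
             S = (\<lambda>(E, F). (E, e_vec E F)) ` PP C j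
         in c10_submanifold (subtopology fell_topology B) S \<and>
            inj_on (\<lambda>(E, F). (E, e_vec E F)) (PP C j) \<and>
            (\<forall>(E, F)\<in>PP C j. tangent_space {x. (E, x) \<in> S} (e_vec E F) = E_half E F)"
proof -
  define C where "C = dual_cone \<Omega>"
  define r where "r = fdim_n C (fdepth C - (j - 1))"
  define m where "m = fdim_n C (fdepth C - j)"
  have j: "1 \<le> j" "j \<le> fdepth C" using assms by (auto simp: C_def)
  \<comment> \<open>Without face dimensions, truncated subtraction would give
    \<open>fdepth C = 0\<close>, contrary to the bounds on \<open>j\<close>.\<close>
  have ne: "face_dims C \<noteq> {}"
    using j by (auto simp: fdepth_def)
  interpret face_gap C r m
  proof
    show "m < r" unfolding m_def r_def by (rule fdim_n_strict_mono[OF _ _ ne]) (use j in auto)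
    fix G assume "G \<in> faces C" "dim G < r"
    then obtain i where i: "i \<le> fdepth C" "fdim_n C i = dim G"
      using fdim_n_surj[of "dim G" C] by (auto simp: face_dims_def)
    have "i < fdepth C - (j - 1)"
    proof (rule ccontr)
      assume "\<not> i < fdepth C - (j - 1)"
      then have "r \<le> fdim_n C i"
        unfolding r_def using fdim_n_strict_mono[OF _ i(1) ne, of "fdepth C - (j - 1)"]
        by (metis le_less_linear less_imp_le nat_less_le order_refl)
      with i \<open>dim G < r\<close> show False by simp
    qed
    \<comment> \<open>As 1 \<le> j \<le> d, the index d - (j - 1) is the successor of d - j, so m
      and r are consecutive dimensions.\<close>
    then have "i \<le> fdepth C - j" using j by linarith
    then show "dim G \<le> m"
      unfolding m_def using fdim_n_strict_mono[OF _ _ ne, of i "fdepth C - j"] i(2)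
      by (metis diff_le_self less_imp_le nat_less_le order_refl)
  qed (use dual_cone_closed_convex_cone[of \<Omega>] facially_compact_subseq[of C] assms(6) in \<open>auto simp: C_def\<close>)
  have PP_iff: "(E, F) \<in> PP C j \<longleftrightarrow> E \<in> faces C \<and> dim E = r \<and> F \<in> faces C \<and> dim F = m \<and> F \<subseteq> E" for E F
    by (auto simp: PP_def Pfaces_def r_def m_def)
  have reg: "regular_point E x" if EF: "(E, F) \<in> PP C j" and x: "x \<in> rel_interior F" for E F x
  proof -
    have E: "E \<in> faces C" "dim E = r" and F: "F \<in> faces C" "dim F = m" "F \<subseteq> E"
      using EF by (auto simp: PP_iff)
    have low: "lower_dim C E = m"
      unfolding lower_dim_def
    proof (rule Max_eqI)
      show "finite {dim G |G. G \<in> faces C \<and> dim G < dim E}"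
        by (rule finite_subset[OF _ finite_face_dims[of C]]) (auto simp: face_dims_def)
      show "y \<le> m" if "y \<in> {dim G |G. G \<in> faces C \<and> dim G < dim E}" for y
        using that gap E(2) by blast
      show "m \<in> {dim G |G. G \<in> faces C \<and> dim G < dim E}" using F E m_less by blast
    qed
    have "modular_face C E"
      unfolding modular_face_def using E F m_less low by metis
    then have "smooth_face C E" using assms(7) by (simp add: locally_smooth_def C_def)
    then have "F face_of E \<and> F \<noteq> {} \<and> dim F = lower_dim C E \<longrightarrow> (\<forall>x\<in>rel_interior F. regular_point E x)"
      unfolding smooth_face_def by blast
    moreover have "F face_of E"
      using face_of_subset[of F C E] F E face_props(5)[OF E(1)] by (simp add: faces_def)
    ultimately show ?thesis
      using x F(2) low face_props(6)[OF F(1)] by simp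
  qed
  have ev: "norm (e_vec E F) = 1" "e_vec E F \<in> normals E" "contact_face E (e_vec E F) = F"
    "y \<in> orth F \<inter> rel_dual_cone E \<Longrightarrow> norm y = 1 \<Longrightarrow> y = e_vec E F" if "(E, F) \<in> PP C j" for E F y
    using e_vec_normals[of E F] reg[OF that] that unfolding PP_iff by blast+
  define B where "B = xi ` PP C j"
  define S where "S = (\<lambda>(E, F). (E, e_vec E F)) ` PP C j"
  have B: "B \<subseteq> {E \<in> faces C. dim E = r}" by (auto simp: B_def xi_def PP_iff)
  have S: "S = {(E, x). E \<in> B \<and> x \<in> normals E \<and> norm x = 1}"
  proof
    show "S \<subseteq> {(E, x). E \<in> B \<and> x \<in> normals E \<and> norm x = 1}"
      using ev(1,2) by (force simp: S_def B_def xi_def)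
    \<comment> \<open>The contact face of a unit normal supplies the missing face: it has dimension
      m, and uniqueness of the ray generator identifies the normal with
      \<open>e_vec\<close>.\<close>
    show "{(E, x). E \<in> B \<and> x \<in> normals E \<and> norm x = 1} \<subseteq> S"
    proof clarify
      fix E x assume x: "E \<in> B" "x \<in> normals E" "norm x = 1"
      let ?F = "contact_face E x"
      have E: "E \<in> faces C" "dim E = r" using x(1) B by auto
      have "(E, ?F) \<in> PP C j"
        using E x(2) contact_face_in_faces[OF E(1), of x] by (auto simp: PP_iff normals_def contact_face_def)
      moreover have "x \<in> orth ?F \<inter> rel_dual_cone E"
        using x(2) by (auto simp: orth_def contact_face_def normals_def rel_dual_cone_def dual_cone_def)
      ultimately show "(E, x) \<in> S"
        using ev(4)[of E ?F x] x(3) by (force simp: S_def)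
    qed
  qed
  have "c10_submanifold (subtopology fell_topology B) S"
    unfolding S by (rule c10_submanifold_normals[OF B])
  moreover have "inj_on (\<lambda>(E, F). (E, e_vec E F)) (PP C j)"
    \<comment> \<open>\<open>F\<close> is recovered as the contact face of
      \<open>e_vec E F\<close>.\<close>
    by (rule inj_onI) (use ev(3) in \<open>clarsimp, metis\<close>)
  moreover have "tangent_space {x. (E, x) \<in> S} (e_vec E F) = E_half E F" if EF: "(E, F) \<in> PP C j" for E F
  proof -
    have EB: "E \<in> B" using EF by (force simp: B_def xi_def)
    interpret face_chart C r m B E "e_vec E F"
      using EB B ev[OF EF] by unfold_locales auto
    have "{x. (E, x) \<in> S} = {x \<in> normals E. norm x = 1}" using EB by (auto simp: S)
    then show ?thesis
      using tangent_space_normals by (simp add: L_def E_half_def ev(3)[OF EF])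
  qed
  ultimately show ?thesis unfolding Let_def C_def[symmetric] B_def[symmetric] S_def[symmetric] by auto
qed

end
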